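(* Let $\mathcal{L}$ be a finite relational language and let $\mathcal{T}$ be a finite set of finite $\mathcal{L}$-structures each of which is a Gaifman clique. Suppose $C_1\subseteq C_2$ are finite $\mathcal{T}$-free $\mathcal{L}$-structures and $(D_1,\phi_1)$ is a finite $\mathcal{T}$-free HL-extension of $C_1$. Then there is a finite $\mathcal{T}$-free HL-extension $(D_2,\phi_2)$ of $C_2$ such that $(D_2,\phi_2)$ is coherent with $(D_1,\phi_1)$.
   Context: Basic notions. $C_1\subseteq C_2$ means that $C_1$ is a substructure of $C_2$. $D$ is an extension of $C$ (or $D$ extends $C$) if $C$ is a substructure of $D$; interchangeably, the same terminology is used when $D$ contains an isomorphic copy of $C$. A homomorphism $h:M\to N$ of $\mathcal{L}$-structures is a map such that $R^M(a_1,\dots,a_m)$ implies $R^N(h(a_1),\dots,h(a_m))$ for every $m$-ary $R\in\mathcal{L}$. $M$ is $\mathcal{T}$-free if no $T\in\mathcal{T}$ admits a homomorphism $T\to M$. An $\mathcal{L}$-structure $C$ is a Gaifman clique if for every $a,b\in C$ there are a relation symbol $R\in\mathcal{L}$ of arity $m\ge2$ and $c_1,\dots,c_m\in C$ with $a,b\in\{c_1,\dots,c_m\}$ and $R^C(c_1,\dots,c_m)$. HL-extensions. A partial isomorphism of $C$ is an isomorphism between two finite substructures of $C$. $\mathcal{P}_C$ denotes the set of partial isomorphisms of $C$ that are not restrictions of the identity map $1_C$. If $C_1\subseteq C_2$ then $\mathcal{P}_{C_1}\subseteq\mathcal{P}_{C_2}$. An HL-extension of $C$ is a pair $(D,\phi)$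 where $D$ is an extension of $C$ and $\phi:\mathcal{P}_C\to\mathrm{Aut}(D)$ is such that $\phi(p)$ extends $p$ for all $p\in\mathcal{P}_C$; it is tacitly assumed that $\phi(p^{-1})=\phi(p)^{-1}$. It is finite ($\mathcal{T}$-free) if $D$ is. Coherence. Let $C_1\subseteq C_2$ be $\mathcal{L}$-structures and let $(D_i,\phi_i)$ be an HL-extension of $C_i$ for $i=1,2$. They are coherent if (i) $D_2$ extends $D_1$; (ii) $\phi_2(p)$ extends $\phi_1(p)$ for all $p\in\mathcal{P}_{C_1}\subseteq\mathcal{P}_{C_2}$; (iii) letting $K_i=\langle\phi_i(\mathcal{P}_{C_i})\rangle\le\mathrm{Aut}(D_i)$ for $i=1,2$, and letting $\kappa:\phi_1(\mathcal{P}_{C_1})\to\phi_2(\mathcal{P}_{C_2})$ be such that $\kappa(\phi_1(p))=\phi_2(p)$ for all $p\in\mathcal{P}_{C_1}$, the map $\kappa$ has a unique extension to a group isomorphic embedding (injective homomorphism) from $K_1$ into $K_2$. *)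

theory Defs
  imports "HOL-Algebra.Algebra"
begin

section \<open>Relational languages and structures\<close>

record 'r language =
  symbols :: "'r set"
  arity :: "'r \<Rightarrow> nat"

text \<open>
  A tuple is a list. The interpretation of an \<open>r\<close> outside \<open>symbols L\<close> is
  irrelevant and is never inspected. Structures may be empty.
\<close>

record ('a, 'r) rel_structure =
  universe :: "'a set"
  interp :: "'r \<Rightarrow> 'a list set"

definition is_structure :: "'r language \<Rightarrow> ('a, 'r) rel_structure \<Rightarrow> bool" where
  "is_structure L M \<longleftrightarrow>
     (\<forall>R\<in>symbols L. interp M R \<subseteq> {xs. length xs = arity L R \<and> set xs \<subseteq> universe M})"

definition finite_structure :: "('a, 'r) rel_structure \<Rightarrow> bool" where
  "finite_structure M \<longleftrightarrow> finite (universe M)"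

definition substructure ::
  "'r language \<Rightarrow> ('a, 'r) rel_structure \<Rightarrow> ('a, 'r) rel_structure \<Rightarrow> bool" where
  "substructure L M N \<longleftrightarrow>
     universe M \<subseteq> universe N \<and> (\<forall>R\<in>symbols L. interp M R = {xs \<in> interp N R. set xs \<subseteq> universe M})"

definition homomorphism ::
  "'r language \<Rightarrow> ('a, 'r) rel_structure \<Rightarrow> ('b, 'r) rel_structure \<Rightarrow> ('a \<Rightarrow> 'b) \<Rightarrow> bool" where
  "homomorphism L M N h \<longleftrightarrow>
     h \<in> universe M \<rightarrow> universe N \<and>
     (\<forall>R\<in>symbols L. \<forall>xs\<in>interp M R. map h xs \<in> interp N R)"

definition isomorphism ::
  "'r language \<Rightarrow> ('a, 'r) rel_structure \<Rightarrow> ('b, 'r) rel_structure \<Rightarrow> ('a \<Rightarrow> 'b) \<Rightarrow> bool" where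
  "isomorphism L M N h \<longleftrightarrow>
     bij_betw h (universe M) (universe N) \<and>
     (\<forall>R\<in>symbols L. \<forall>xs\<in>lists (universe M). xs \<in> interp M R \<longleftrightarrow> map h xs \<in> interp N R)"

definition is_free ::
  "'r language \<Rightarrow> ('t, 'r) rel_structure set \<Rightarrow> ('a, 'r) rel_structure \<Rightarrow> bool" where
  "is_free L \<T> M \<longleftrightarrow> \<not> (\<exists>T\<in>\<T>. \<exists>h. homomorphism L T M h)"

definition gaifman_clique :: "'r language \<Rightarrow> ('a, 'r) rel_structure \<Rightarrow> bool" where
  "gaifman_clique L C \<longleftrightarrow>
     (\<forall>a\<in>universe C. \<forall>b\<in>universe C. \<exists>R\<in>symbols L. arity L R \<ge> 2 \<and>
        (\<exists>cs\<in>interp C R. a \<in> set cs \<and> b \<in> set cs))"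

text \<open>
  ``\<open>D\<close> extends \<open>C\<close>'' is understood up to isomorphism: \<open>D\<close> contains an isomorphic copy
  of \<open>C\<close>. The map \<open>\<iota>\<close> onto that copy is kept explicit, because ``\<open>\<phi>(p)\<close> extends \<open>p\<close>''
  refers to it. Literal inclusion is the case where \<open>\<iota>\<close> is the identity.
\<close>

definition extends_via ::
  "'r language \<Rightarrow> ('a, 'r) rel_structure \<Rightarrow> ('b, 'r) rel_structure \<Rightarrow> ('a \<Rightarrow> 'b) \<Rightarrow> bool" where
  "extends_via L C D \<iota> \<longleftrightarrow> (\<exists>C'. substructure L C' D \<and> isomorphism L C C' \<iota>)"


section \<open>Automorphism groups\<close>

text \<open>Automorphisms are extensional on \<open>universe D\<close>, as in \<^term>\<open>BijGroup\<close>.\<close>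

definition Aut_group :: "'r language \<Rightarrow> ('a, 'r) rel_structure \<Rightarrow> ('a \<Rightarrow> 'a) monoid" where
  "Aut_group L D = (BijGroup (universe D))
     \<lparr>carrier := {g \<in> extensional (universe D). isomorphism L D D g}\<rparr>"

lemma isomorphism_inv_into:
  assumes "isomorphism L M N g"
  shows "isomorphism L N M (inv_into (universe M) g)"
proof -
  have b: "bij_betw g (universe M) (universe N)" using assms by (simp add: isomorphism_def)
  have "xs \<in> interp N R \<longleftrightarrow> map (inv_into (universe M) g) xs \<in> interp M R"
    if R: "R \<in> symbols L" and xs: "xs \<in> lists (universe N)" for R xs
  proof -
    let ?ys = "map (inv_into (universe M) g) xs"
    have "?ys \<in> lists (universe M)"
      using xs bij_betw_apply[OF bij_betw_inv_into[OF b]] by auto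
    moreover have "map g ?ys = xs"
      using xs b by (auto simp: bij_betw_inv_into_right intro!: map_idI)
    ultimately show ?thesis using assms R by (metis isomorphism_def)
  qed
  then show ?thesis using bij_betw_inv_into[OF b] by (simp add: isomorphism_def)
qed

lemma isomorphism_cong:
  assumes "\<And>x. x \<in> universe M \<Longrightarrow> f x = g x"
  shows "isomorphism L M N f \<longleftrightarrow> isomorphism L M N g"
proof -
  have "map f xs = map g xs" if "xs \<in> lists (universe M)" for xs
    using that assms by auto
  then have "(xs \<in> interp M R \<longleftrightarrow> map f xs \<in> interp N R) \<longleftrightarrow> (xs \<in> interp M R \<longleftrightarrow> map g xs \<in> interp N R)"
    if "xs \<in> lists (universe M)" for R xs
    using that by metis
  moreover have "bij_betw f (universe M) (universe N) \<longleftrightarrow> bij_betw g (universe M) (universe N)"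
    using assms by (rule bij_betw_cong)
  ultimately show ?thesis
    unfolding isomorphism_def by (metis (no_types, lifting))
qed

lemma isomorphism_comp:
  assumes f: "isomorphism L M N f" and g: "isomorphism L N K g"
  shows "isomorphism L M K (g \<circ> f)"
proof -
  have "map f xs \<in> lists (universe N)" if "xs \<in> lists (universe M)" for xs
    using that f bij_betw_apply[of f "universe M" "universe N"] by (auto simp: isomorphism_def)
  then show ?thesis
    using f g by (auto simp: isomorphism_def intro: bij_betw_trans simp flip: map_map)
qed

lemma subgroup_Aut: "subgroup (carrier (Aut_group L D)) (BijGroup (universe D))"
proof (rule group.subgroupI[OF group_BijGroup])
  let ?A = "carrier (Aut_group L D)"
  have sub: "?A \<subseteq> Bij (universe D)"
    by (auto simp: Aut_group_def Bij_def isomorphism_def)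
  then show "?A \<subseteq> carrier (BijGroup (universe D))" by (simp add: BijGroup_def)
  have "isomorphism L D D (\<lambda>x. x)" by (simp add: isomorphism_def bij_betw_def)
  then have "isomorphism L D D (\<lambda>x\<in>universe D. x)"
    by (subst isomorphism_cong[of D _ "\<lambda>x. x"]) auto
  then show "?A \<noteq> {}" by (auto simp: Aut_group_def)
  show "inv\<^bsub>BijGroup (universe D)\<^esub> g \<in> ?A" if g: "g \<in> ?A" for g
  proof -
    have "inv\<^bsub>BijGroup (universe D)\<^esub> g = restrict (inv_into (universe D) g) (universe D)"
      using sub g by (intro inv_BijGroup) auto
    moreover have "isomorphism L D D (restrict (inv_into (universe D) g) (universe D))"
      using isomorphism_inv_into[of L D D g] g
      by (subst isomorphism_cong[of D _ "inv_into (universe D) g"]) (auto simp: Aut_group_def)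
    ultimately show ?thesis by (simp add: Aut_group_def)
  qed
  show "f \<otimes>\<^bsub>BijGroup (universe D)\<^esub> g \<in> ?A" if f: "f \<in> ?A" and g: "g \<in> ?A" for f g
  proof -
    have "f \<otimes>\<^bsub>BijGroup (universe D)\<^esub> g = compose (universe D) f g"
      using sub f g by (auto simp: BijGroup_def)
    moreover have "isomorphism L D D (compose (universe D) f g)"
      using isomorphism_comp[of L D D g D f] f g
      by (subst isomorphism_cong[of D _ "f \<circ> g"]) (auto simp: Aut_group_def compose_def)
    ultimately show ?thesis by (simp add: Aut_group_def)
  qed
qed

lemma group_Aut_group: "group (Aut_group L D)"
proof -
  have "Aut_group L D = (BijGroup (universe D))\<lparr>carrier := carrier (Aut_group L D)\<rparr>"
    by (simp add: Aut_group_def)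
  then show ?thesis
    using group.subgroup_imp_group[OF group_BijGroup subgroup_Aut] by metis
qed


section \<open>Partial isomorphisms and HL-extensions\<close>

text \<open>
  A partial isomorphism is represented by its graph, so that its inverse is the converse
  relation, and it is a restriction of the identity iff it is contained in \<^term>\<open>Id\<close>.
\<close>

definition partial_isos :: "'r language \<Rightarrow> ('a, 'r) rel_structure \<Rightarrow> ('a \<times> 'a) set set" where
  "partial_isos L C = {p. \<exists>A B f.
      substructure L A C \<and> finite_structure A \<and> substructure L B C \<and> finite_structure B \<and>
      isomorphism L A B f \<and> p = (\<lambda>x. (x, f x)) ` universe A}"

definition nonid_partial_isos ::
  "'r language \<Rightarrow> ('a, 'r) rel_structure \<Rightarrow> ('a \<times> 'a) set set" where
  "nonid_partial_isos L C = {p \<in> partial_isos L C. \<not> p \<subseteq> Id}"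

text \<open>Only the values of \<open>\<phi>\<close> on \<open>nonid_partial_isos L C\<close> are relevant.\<close>

definition HL_extension ::
  "'r language \<Rightarrow> ('a, 'r) rel_structure \<Rightarrow> ('b, 'r) rel_structure \<Rightarrow> ('a \<Rightarrow> 'b) \<Rightarrow>
   (('a \<times> 'a) set \<Rightarrow> 'b \<Rightarrow> 'b) \<Rightarrow> bool" where
  "HL_extension L C D \<iota> \<phi> \<longleftrightarrow>
     is_structure L D \<and> extends_via L C D \<iota> \<and>
     \<phi> \<in> nonid_partial_isos L C \<rightarrow> carrier (Aut_group L D) \<and>
     (\<forall>p\<in>nonid_partial_isos L C.
        (\<forall>(x, y)\<in>p. \<phi> p (\<iota> x) = \<iota> y) \<and>
        \<phi> (p\<inverse>) = inv\<^bsub>Aut_group L D\<^esub> (\<phi> p))"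

definition HL_group ::
  "'r language \<Rightarrow> ('a, 'r) rel_structure \<Rightarrow> ('b, 'r) rel_structure \<Rightarrow>
   (('a \<times> 'a) set \<Rightarrow> 'b \<Rightarrow> 'b) \<Rightarrow> ('b \<Rightarrow> 'b) monoid" where
  "HL_group L C D \<phi> = subgroup_generated (Aut_group L D) (\<phi> ` nonid_partial_isos L C)"

text \<open>
  \<open>\<epsilon>\<close> witnesses that \<open>D2\<close> extends \<open>D1\<close>; it agrees with the inclusion of \<open>C1\<close> in \<open>C2\<close>, as is
  automatic for literal inclusions. In the last clause, homomorphisms are taken extensional
  so that uniqueness refers to maps on the group generated by \<open>\<phi>1\<close>. Existence of \<open>\<kappa>\<close> says
  that the assignment \<open>\<phi>1 p \<mapsto> \<phi>2 p\<close> is well defined.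
\<close>

definition coherent ::
  "'r language \<Rightarrow>
   ('a, 'r) rel_structure \<Rightarrow> ('b, 'r) rel_structure \<Rightarrow> ('a \<Rightarrow> 'b) \<Rightarrow> (('a \<times> 'a) set \<Rightarrow> 'b \<Rightarrow> 'b) \<Rightarrow>
   ('a, 'r) rel_structure \<Rightarrow> ('c, 'r) rel_structure \<Rightarrow> ('a \<Rightarrow> 'c) \<Rightarrow> (('a \<times> 'a) set \<Rightarrow> 'c \<Rightarrow> 'c) \<Rightarrow>
   bool" where
  "coherent L C1 D1 \<iota>1 \<phi>1 C2 D2 \<iota>2 \<phi>2 \<longleftrightarrow>
     (\<exists>\<epsilon>. extends_via L D1 D2 \<epsilon> \<and> (\<forall>x\<in>universe C1. \<epsilon> (\<iota>1 x) = \<iota>2 x) \<and>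
          (\<forall>p\<in>nonid_partial_isos L C1. \<forall>d\<in>universe D1. \<phi>2 p (\<epsilon> d) = \<epsilon> (\<phi>1 p d))) \<and>
     (\<exists>\<kappa>. (\<forall>p\<in>nonid_partial_isos L C1. \<kappa> (\<phi>1 p) = \<phi>2 p) \<and>
          (\<exists>!h. h \<in> mon (HL_group L C1 D1 \<phi>1) (HL_group L C2 D2 \<phi>2) \<and>
                h \<in> extensional (carrier (HL_group L C1 D1 \<phi>1)) \<and>
                (\<forall>g\<in>\<phi>1 ` nonid_partial_isos L C1. h g = \<kappa> g)))"

lemma substructure_trans:
  "substructure L A B \<Longrightarrow> substructure L B C \<Longrightarrow> substructure L A C"
  unfolding substructure_def by blast

lemma nonid_partial_isos_mono:
  "substructure L C1 C2 \<Longrightarrow> nonid_partial_isos L C1 \<subseteq> nonid_partial_isos L C2"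
  unfolding nonid_partial_isos_def partial_isos_def by (blast intro: substructure_trans)

lemma nonid_partial_isos_converse:
  assumes "p \<in> nonid_partial_isos L C"
  shows "p\<inverse> \<in> nonid_partial_isos L C"
proof -
  obtain A B f where AB: "substructure L A C" "finite_structure A" "substructure L B C"
      "finite_structure B" and f: "isomorphism L A B f" and p: "p = (\<lambda>x. (x, f x)) ` universe A"
    and n: "\<not> p \<subseteq> Id"
    using assms unfolding nonid_partial_isos_def partial_isos_def by blast
  have b: "bij_betw f (universe A) (universe B)" using f by (simp add: isomorphism_def)
  have "p\<inverse> = (\<lambda>x. (x, inv_into (universe A) f x)) ` universe B"
    using b by (force simp: p bij_betw_def image_iff)
  moreover have "\<not> p\<inverse> \<subseteq> Id" using n by (metis converse_Id converse_mono)
  ultimately show ?thesis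
    unfolding nonid_partial_isos_def partial_isos_def
    using AB isomorphism_inv_into[OF f] by blast
qed

end

theory Submission
  imports Defs
begin

text \<open>
  The free amalgam \<open>E\<close> of \<open>D1\<close> and \<open>C2\<close> over \<open>C1\<close> is \<open>\<T>\<close>-free, since the image of a
  clique lies in one of the two factors. It suffices to
  embed \<open>E\<close> in a finite \<open>\<T>\<close>-free structure together with an extension \<open>\<Phi> p\<close> of every partial
  isomorphism \<open>p\<close> of \<open>E\<close> to an automorphism, in such a way that \<open>\<Phi> (p O q) = \<Phi> q \<circ> \<Phi> p\<close> whenever
  \<^term>\<open>Range p = Domain q\<close>: automorphisms of \<open>D1\<close> are partial isomorphisms of \<open>E\<close>, so functoriality
  turns \<open>\<Phi>\<close> into a homomorphism on \<open>Aut(D1)\<close>, and it also yields \<open>\<Phi> (p\<inverse>) = (\<Phi> p)\<^sup>-\<^sup>1\<close>.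

  Such an extension is built with valuation functions, in the style of Hubicka, Konecny and
  Nesetril. First, points of \<open>E\<close> are decorated with marks on tuples, and a tuple is related iff the
  number of its marks is odd; an arbitrary permutation extending \<open>p\<close> lifts after switching an even
  number of marks at each tuple. Second, every homomorphic image \<open>I\<close> of some \<open>T \<in> \<T>\<close> is destroyed:
  points get values below \<open>card I - 1\<close>, and only tuples whose entries in \<open>I\<close> have distinct values are
  kept. The embedding of \<open>E\<close> survives: as \<open>E\<close> is \<open>\<T>\<close>-free, it contains at most \<open>card I - 1\<close>
  points of \<open>I\<close>.
\<close>

section \<open>Functorial extension of partial injections\<close>

definition partial_injections :: "'a set \<Rightarrow> ('a \<times> 'a) set set" where
  "partial_injections W = {p. p \<subseteq> W \<times> W \<and> single_valued p \<and> single_valued (p\<inverse>)}"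

lemma partial_injections_converse:
  "p \<in> partial_injections W \<Longrightarrow> p\<inverse> \<in> partial_injections W"
  unfolding partial_injections_def by auto

lemma bij_betw_Domain_Range:
  assumes "single_valued p" "single_valued (p\<inverse>)"
  shows "bij_betw (\<lambda>x. THE y. (x, y) \<in> p) (Domain p) (Range p)"
proof -
  let ?f = "\<lambda>x. THE y. (x, y) \<in> p"
  have eq: "?f x = y" if "(x, y) \<in> p" for x y
    using that assms(1) by (auto dest: single_valuedD)
  have "inj_on ?f (Domain p)"
  proof (rule inj_onI)
    fix x x' assume "x \<in> Domain p" "x' \<in> Domain p" "?f x = ?f x'"
    then obtain y where "(x, y) \<in> p" "(x', y) \<in> p" using eq by fastforce
    then show "x = x'" using assms(2) by (meson converseI single_valuedD)
  qed
  moreover have "?f ` Domain p = Range p"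
  proof
    show "?f ` Domain p \<subseteq> Range p" using eq by fastforce
    show "Range p \<subseteq> ?f ` Domain p" using eq by (force simp: image_iff)
  qed
  ultimately show ?thesis by (simp add: bij_betw_def)
qed

text \<open>Partial injections, composable when range and domain match, form a groupoid, and
  \<open>H\<close> is a functor from it to the permutations of \<open>W\<close>. The condition
  \<open>Range p = Domain q\<close> is essential: with \<open>q = {}\<close> an unrestricted
  \<open>comp\<close> would force every \<open>H p\<close> to be the identity on
  \<open>W\<close>.\<close>

locale functorial_extension =
  fixes W :: "'a set" and H :: "('a \<times> 'a) set \<Rightarrow> 'a \<Rightarrow> 'a"
  assumes maps: "p \<in> partial_injections W \<Longrightarrow> w \<in> W \<Longrightarrow> H p w \<in> W"
    and extends: "p \<in> partial_injections W \<Longrightarrow> (x, y) \<in> p \<Longrightarrow> H p x = y"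
    and comp: "p \<in> partial_injections W \<Longrightarrow> q \<in> partial_injections W \<Longrightarrow> Range p = Domain q \<Longrightarrow>
      w \<in> W \<Longrightarrow> H (p O q) w = H q (H p w)"
    and ident: "S \<subseteq> W \<Longrightarrow> w \<in> W \<Longrightarrow> H (Id_on S) w = w"
begin

lemma converse_cancel:
  assumes "p \<in> partial_injections W" "w \<in> W"
  shows "H (p\<inverse>) (H p w) = w"
proof -
  have "p O p\<inverse> = Id_on (Domain p)"
    using assms(1) unfolding partial_injections_def single_valued_def by blast
  moreover have "Domain p \<subseteq> W" using assms(1) by (auto simp: partial_injections_def)
  ultimately show ?thesis
    using comp[OF assms(1) partial_injections_converse[OF assms(1)] _ assms(2)] ident assms(2) by simp
qed

lemma inj: "p \<in> partial_injections W \<Longrightarrow> inj_on (H p) W"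
  by (metis converse_cancel inj_onI)

lemma converse_cancel':
  assumes "p \<in> partial_injections W" "w \<in> W"
  shows "H p (H (p\<inverse>) w) = w"
  using converse_cancel[OF partial_injections_converse[OF assms(1)] assms(2)] by simp

text \<open>By injectivity \<open>H p\<close> maps no point outside the domain into the range. A
  tuple therefore lies in \<open>Domain p\<close> exactly when its image lies in
  \<open>Range p\<close>, which the parity count uses.\<close>

lemma mem_Range_iff:
  assumes "p \<in> partial_injections W" "w \<in> W"
  shows "H p w \<in> Range p \<longleftrightarrow> w \<in> Domain p"
proof
  assume "H p w \<in> Range p"
  then obtain x where x: "(x, H p w) \<in> p" by blast
  then have "H p x = H p w" "x \<in> W" using assms extends by (auto simp: partial_injections_def)
  then show "w \<in> Domain p" using inj[OF assms(1)] assms(2) x by (auto dest: inj_onD)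
next
  assume "w \<in> Domain p"
  then show "H p w \<in> Range p" using extends[OF assms(1)] by blast
qed

end

text \<open>Off the domain of \<open>p\<close>, go through fixed enumerations of the complements of
  \<^term>\<open>Domain p\<close> and \<^term>\<open>Range p\<close>, which makes the extension functorial.\<close>

lemma functorial_extension_exists:
  assumes "finite W"
  shows "\<exists>H. functorial_extension W H"
proof -
  have "\<forall>S. \<exists>e. bij_betw e (W - S) {0..<card (W - S)}"
    using assms by (meson finite_Diff ex_bij_betw_finite_nat)
  then obtain e where e: "bij_betw (e S) (W - S) {0..<card (W - S)}" for S by metis
  define H where "H p w = (if w \<in> Domain p then THE y. (w, y) \<in> p
    else inv_into (W - Range p) (e (Range p)) (e (Domain p) w))" for p w
  have H_in: "H p x = y" if "p \<in> partial_injections W" "(x, y) \<in> p" for p x y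
    using that by (auto simp: H_def partial_injections_def dest: single_valuedD)
  have card: "card (W - Domain p) = card (W - Range p)" if "p \<in> partial_injections W" for p
  proof -
    have "card (Domain p) = card (Range p)"
      using that bij_betw_same_card[OF bij_betw_Domain_Range] by (auto simp: partial_injections_def)
    moreover have "Domain p \<subseteq> W" "Range p \<subseteq> W" using that by (auto simp: partial_injections_def)
    ultimately show ?thesis using assms by (simp add: card_Diff_subset finite_subset)
  qed
  \<comment> \<open>Off the domain, \<open>H p\<close> preserves the index in the enumeration; by
    \<open>card\<close> every index is available in the other complement. As
    \<open>e (Range p)\<close> is injective, values are later identified by comparing
    indices.\<close>
  have H_out: "H p w \<in> W - Range p \<and> e (Range p) (H p w) = e (Domain p) w"
    if p: "p \<in> partial_injections W" and w: "w \<in> W" "w \<notin> Domain p" for p w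
  proof -
    have "e (Domain p) w \<in> e (Range p) ` (W - Range p)"
      using e[of "Domain p"] e[of "Range p"] w card[OF p] by (auto simp: bij_betw_def)
    then show ?thesis
      using w inv_into_into[of _ "e (Range p)" "W - Range p"] by (simp add: H_def f_inv_into_f)
  qed
  have maps: "H p w \<in> W" if "p \<in> partial_injections W" "w \<in> W" for p w
    using that H_in[OF that(1)] H_out[OF that]
    by (cases "w \<in> Domain p") (auto simp: partial_injections_def)
  have pinj: "p O q \<in> partial_injections W"
    if "p \<in> partial_injections W" "q \<in> partial_injections W" for p q
    using that by (auto simp: partial_injections_def converse_relcomp intro!: single_valued_relcomp)
  show ?thesis
  proof (intro exI[of _ H], unfold_locales)
    fix p q w
    assume p: "p \<in> partial_injections W" and q: "q \<in> partial_injections W"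
      and pq: "Range p = Domain q" and w: "w \<in> W"
    have dom: "Domain (p O q) = Domain p" "Range (p O q) = Range q" using pq by blast+
    show "H (p O q) w = H q (H p w)"
    proof (cases "w \<in> Domain p")
      case True
      then obtain y z where yz: "(w, y) \<in> p" "(y, z) \<in> q" using pq by blast
      then show ?thesis using H_in[OF p] H_in[OF q] H_in[OF pinj[OF p q], of w z] by auto
    next
      case False
      have 1: "H p w \<in> W - Domain q" "e (Domain q) (H p w) = e (Domain p) w"
        using H_out[OF p w False] pq by auto
      have "H q (H p w) \<in> W - Range q" "e (Range q) (H q (H p w)) = e (Domain p) w"
        using H_out[OF q, of "H p w"] 1 by auto
      moreover have "H (p O q) w \<in> W - Range q" "e (Range q) (H (p O q) w) = e (Domain p) w"
        using H_out[OF pinj[OF p q] w] False dom by auto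
      ultimately show ?thesis
        using e[of "Range q"] by (metis bij_betw_def inj_onD)
    qed
  next
    fix S w
    assume S: "S \<subseteq> W" and w: "w \<in> W"
    have p: "Id_on S \<in> partial_injections W"
      using S by (auto simp: partial_injections_def)
    show "H (Id_on S) w = w"
    proof (cases "w \<in> S")
      case True
      then show ?thesis by (intro H_in[OF p]) auto
    next
      case False
      then have "H (Id_on S) w \<in> W - S" "e S (H (Id_on S) w) = e S w"
        using H_out[OF p w] by auto
      then show ?thesis using e[of S] False w by (metis bij_betw_def inj_onD DiffI)
    qed
  qed (use maps H_in in auto)
qed


section \<open>Coherent extensions\<close>

definition embedding ::
  "'r language \<Rightarrow> ('a, 'r) rel_structure \<Rightarrow> ('b, 'r) rel_structure \<Rightarrow> ('a \<Rightarrow> 'b) \<Rightarrow> bool" where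
  "embedding L C D \<iota> \<longleftrightarrow>
     inj_on \<iota> (universe C) \<and> \<iota> ` universe C \<subseteq> universe D \<and>
     (\<forall>R\<in>symbols L. \<forall>xs\<in>lists (universe C). xs \<in> interp C R \<longleftrightarrow> map \<iota> xs \<in> interp D R)"

lemma extends_via_iff_embedding: "extends_via L C D \<iota> \<longleftrightarrow> embedding L C D \<iota>"
proof
  assume "extends_via L C D \<iota>"
  then obtain C' where sub: "substructure L C' D" and iso: "isomorphism L C C' \<iota>"
    unfolding extends_via_def by blast
  have im: "\<iota> ` universe C = universe C'" and inj: "inj_on \<iota> (universe C)"
    using iso by (auto simp: isomorphism_def bij_betw_def)
  have "xs \<in> interp C R \<longleftrightarrow> map \<iota> xs \<in> interp D R"
    if "R \<in> symbols L" "xs \<in> lists (universe C)" for R xs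
  proof -
    have "set (map \<iota> xs) \<subseteq> universe C'" using that im by auto
    then show ?thesis using that sub iso by (simp add: isomorphism_def substructure_def)
  qed
  then show "embedding L C D \<iota>"
    using im inj sub by (simp add: embedding_def substructure_def)
next
  assume e: "embedding L C D \<iota>"
  define C' where "C' = \<lparr>universe = \<iota> ` universe C,
    interp = (\<lambda>R. {xs \<in> interp D R. set xs \<subseteq> \<iota> ` universe C})\<rparr>"
  have "substructure L C' D"
    using e by (simp add: C'_def substructure_def embedding_def)
  moreover have "isomorphism L C C' \<iota>"
    using e by (auto simp: C'_def isomorphism_def embedding_def bij_betw_def)
  ultimately show "extends_via L C D \<iota>" unfolding extends_via_def by blast
qed

lemma embedding_comp:
  assumes f: "embedding L A B f" and g: "embedding L B C g"
  shows "embedding L A C (g \<circ> f)"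
proof -
  have "f ` universe A \<subseteq> universe B" using f by (simp add: embedding_def)
  then have "map f xs \<in> lists (universe B)" if "xs \<in> lists (universe A)" for xs
    using that by (auto simp: image_subset_iff)
  then show ?thesis
    using f g comp_inj_on[of f "universe A" g] inj_on_subset[of g "universe B"]
    unfolding embedding_def map_map[symmetric] by (auto simp del: map_map simp: image_subset_iff)
qed

text \<open>As in \<^const>\<open>partial_isos\<close>, a partial isomorphism is a graph; \<^const>\<open>list_all2\<close> replaces the
  application of the underlying function to a tuple, which keeps the definition symmetric.\<close>

definition iso_graphs :: "'r language \<Rightarrow> ('a, 'r) rel_structure \<Rightarrow> ('a \<times> 'a) set set" where
  "iso_graphs L E = {p \<in> partial_injections (universe E).
     \<forall>R\<in>symbols L. \<forall>xs ys. list_all2 (\<lambda>x y. (x, y) \<in> p) xs ys \<longrightarrow>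
       (xs \<in> interp E R \<longleftrightarrow> ys \<in> interp E R)}"

lemma iso_graphs_converse:
  assumes "p \<in> iso_graphs L E"
  shows "p\<inverse> \<in> iso_graphs L E"
proof -
  have "list_all2 (\<lambda>x y. (x, y) \<in> p\<inverse>) xs ys \<longleftrightarrow> list_all2 (\<lambda>x y. (x, y) \<in> p) ys xs" for xs ys
    by (auto simp: list_all2_conv_all_nth)
  then show ?thesis
    using assms partial_injections_converse unfolding iso_graphs_def by auto
qed

lemma iso_graphs_Id_on: "S \<subseteq> universe E \<Longrightarrow> Id_on S \<in> iso_graphs L E"
proof -
  have "xs = ys" if "list_all2 (\<lambda>x y. (x, y) \<in> Id_on S) xs ys" for xs ys
    using that by (auto simp: list_all2_conv_all_nth intro!: nth_equalityI)
  then show "S \<subseteq> universe E \<Longrightarrow> Id_on S \<in> iso_graphs L E"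
    unfolding iso_graphs_def partial_injections_def by auto
qed

lemma iso_graphs_partial_injections: "p \<in> iso_graphs L E \<Longrightarrow> p \<in> partial_injections (universe E)"
  by (simp add: iso_graphs_def)

lemma iso_graphs_relcomp_converse: "p \<in> iso_graphs L E \<Longrightarrow> p O p\<inverse> = Id_on (Domain p)"
  unfolding iso_graphs_def partial_injections_def single_valued_def by blast

lemma iso_graphs_Domain_Range:
  "p \<in> iso_graphs L E \<Longrightarrow> Domain p \<subseteq> universe E \<and> Range p \<subseteq> universe E"
  by (auto simp: iso_graphs_def partial_injections_def)

text \<open>Only a homomorphism is demanded of \<open>\<Phi> p\<close>: by \<open>comp\<close> and
  \<open>ident\<close> the map \<open>\<Phi> (p\<inverse>)\<close> is a two-sided inverse, and it is
  a homomorphism too, so \<open>\<Phi> p\<close> is an automorphism. The constructions below check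
  one direction only.\<close>

locale coherent_extension =
  fixes L :: "'r language" and E :: "('a, 'r) rel_structure" and B :: "('b, 'r) rel_structure"
    and \<iota> :: "'a \<Rightarrow> 'b" and \<Phi> :: "('a \<times> 'a) set \<Rightarrow> 'b \<Rightarrow> 'b"
  assumes struct: "is_structure L B"
    and fin: "finite_structure B"
    and emb: "embedding L E B \<iota>"
    and hom: "p \<in> iso_graphs L E \<Longrightarrow> homomorphism L B B (\<Phi> p)"
    and extends: "p \<in> iso_graphs L E \<Longrightarrow> (x, y) \<in> p \<Longrightarrow> \<Phi> p (\<iota> x) = \<iota> y"
    and comp: "p \<in> iso_graphs L E \<Longrightarrow> q \<in> iso_graphs L E \<Longrightarrow> Range p = Domain q \<Longrightarrow>
      b \<in> universe B \<Longrightarrow> \<Phi> (p O q) b = \<Phi> q (\<Phi> p b)"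
    and ident: "S \<subseteq> universe E \<Longrightarrow> b \<in> universe B \<Longrightarrow> \<Phi> (Id_on S) b = b"
begin

lemma maps: "p \<in> iso_graphs L E \<Longrightarrow> b \<in> universe B \<Longrightarrow> \<Phi> p b \<in> universe B"
  using hom unfolding homomorphism_def by auto

lemma converse_cancel:
  assumes "p \<in> iso_graphs L E" "b \<in> universe B"
  shows "\<Phi> (p\<inverse>) (\<Phi> p b) = b"
  using comp[OF assms(1) iso_graphs_converse[OF assms(1)] _ assms(2)] ident assms(2)
    iso_graphs_Domain_Range[OF assms(1)] iso_graphs_relcomp_converse[OF assms(1)]
  by simp

lemma converse_cancel':
  assumes "p \<in> iso_graphs L E" "b \<in> universe B"
  shows "\<Phi> p (\<Phi> (p\<inverse>) b) = b"
  using converse_cancel[OF iso_graphs_converse[OF assms(1)] assms(2)] by simp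

lemma bij: "p \<in> iso_graphs L E \<Longrightarrow> bij_betw (\<Phi> p) (universe B) (universe B)"
  by (rule bij_betwI[where g = "\<Phi> (p\<inverse>)"])
    (auto simp: maps converse_cancel converse_cancel' iso_graphs_converse)

lemma iso:
  assumes p: "p \<in> iso_graphs L E"
  shows "isomorphism L B B (\<Phi> p)"
  unfolding isomorphism_def
proof (intro conjI ballI bij[OF p])
  fix R xs
  assume R: "R \<in> symbols L" and xs: "xs \<in> lists (universe B)"
  have "map (\<Phi> (p\<inverse>)) (map (\<Phi> p) xs) = xs"
    using xs by (auto intro!: map_idI simp: converse_cancel[OF p])
  then show "xs \<in> interp B R \<longleftrightarrow> map (\<Phi> p) xs \<in> interp B R"
    using hom[OF p] hom[OF iso_graphs_converse[OF p]] R unfolding homomorphism_def by metis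
qed

end


section \<open>Extending partial isomorphisms: parity structures\<close>

text \<open>Parity of cardinality is additive under symmetric difference. Since \<open>lift\<close>
  changes marks by exclusive or, the parities of the contributions can be computed
  separately.\<close>

lemma odd_card_neq:
  assumes "finite S"
  shows "odd (card {x \<in> S. P x \<noteq> Q x}) \<longleftrightarrow> (odd (card {x \<in> S. P x}) \<noteq> odd (card {x \<in> S. Q x}))"
proof -
  have step: "odd (card {x \<in> insert a F. T x}) \<longleftrightarrow> T a \<noteq> odd (card {x \<in> F. T x})"
    if "finite F" "a \<notin> F" for a :: 'a and F T
  proof -
    have "{x \<in> insert a F. T x} = (if T a then insert a {x \<in> F. T x} else {x \<in> F. T x})" by auto
    then show ?thesis using that by auto
  qed
  show ?thesis
    using assms
  proof (induction S rule: finite_induct)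
    case (insert a F)
    show ?case unfolding step[OF insert.hyps] insert.IH by blast
  qed simp
qed

locale parity_extension = functorial_extension "universe E" H
  for L :: "'r language" and E :: "('a, 'r) rel_structure" and H :: "('a \<times> 'a) set \<Rightarrow> 'a \<Rightarrow> 'a" +
  assumes fin_symbols: "finite (symbols L)"
    and struct: "is_structure L E"
    and fin: "finite_structure E"
begin

text \<open>A slot at \<open>x\<close> is a possible tuple through \<open>x\<close>, related in
  \<open>E\<close> or not. The decoration of a point over \<open>x\<close> is the set of slots at
  which it is marked.\<close>

definition slots :: "'a \<Rightarrow> ('r \<times> 'a list) set" where
  "slots x = {(R, xs). R \<in> symbols L \<and> xs \<in> lists (universe E) \<and> length xs = arity L R \<and> x \<in> set xs}"

text \<open>The embedding of \<open>E\<close> puts a mark on the first entry of every related tuple. If the marks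
  of the elements of \<open>S\<close> are prescribed in this way, a second mark on the first entry outside
  \<open>S\<close> makes the number of marks even, unless the whole tuple lies in \<open>S\<close>.\<close>

definition marked :: "'a set \<Rightarrow> 'r \<Rightarrow> 'a list \<Rightarrow> 'a \<Rightarrow> bool" where
  "marked S R xs x \<longleftrightarrow> xs \<in> interp E R \<and>
     (if x \<in> S then x = hd xs else hd xs \<in> S \<and> x = hd (filter (\<lambda>z. z \<notin> S) xs))"

text \<open>The count is 1 for a related nonempty tuple inside \<open>S\<close>, 2 for a related
  tuple that starts in \<open>S\<close> and leaves it, and 0 otherwise. Entries are counted as a
  set, so repetitions do not matter.\<close>

lemma odd_marked:
  "odd (card {x \<in> set xs. marked S R xs x}) \<longleftrightarrow> xs \<noteq> [] \<and> set xs \<subseteq> S \<and> xs \<in> interp E R"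
proof (cases "xs \<noteq> [] \<and> xs \<in> interp E R \<and> hd xs \<in> S")
  case True
  then have hd: "hd xs \<in> set xs" by simp
  show ?thesis
  proof (cases "set xs \<subseteq> S")
    case sub: True
    then have "{x \<in> set xs. marked S R xs x} = {hd xs}"
      using True hd by (auto simp: marked_def)
    then show ?thesis using True sub by simp
  next
    case False
    let ?y = "hd (filter (\<lambda>z. z \<notin> S) xs)"
    have "filter (\<lambda>z. z \<notin> S) xs \<noteq> []" using False by (auto simp: filter_empty_conv)
    then have "?y \<in> set (filter (\<lambda>z. z \<notin> S) xs)" using hd_in_set by blast
    then have y: "?y \<in> set xs" "?y \<notin> S" by auto
    then have "{x \<in> set xs. marked S R xs x} = {hd xs, ?y}"
      using True hd by (auto simp: marked_def)
    moreover have "hd xs \<noteq> ?y" using True y by metis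
    ultimately show ?thesis using False by simp
  qed
next
  case False
  then have e: "{x \<in> set xs. marked S R xs x} = {}" by (auto simp: marked_def)
  show ?thesis unfolding e using False by (cases xs) auto
qed

text \<open>Injectivity of \<open>fst\<close> on the entries lets marks be counted over points of
  \<open>E\<close>. An empty tuple has no entry to carry a mark, hence the separate clause for
  nullary symbols.\<close>

definition parity_structure :: "('a \<times> ('r \<times> 'a list) set, 'r) rel_structure" where
  "parity_structure = \<lparr>universe = (SIGMA x:universe E. Pow (slots x)),
     interp = (\<lambda>R. {zs \<in> lists (SIGMA x:universe E. Pow (slots x)).
       length zs = arity L R \<and> inj_on fst (set zs) \<and>
       (zs = [] \<and> [] \<in> interp E R \<or> odd (card {z \<in> set zs. (R, map fst zs) \<in> snd z}))})\<rparr>"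

lemma interp_parity_structure_iff:
  "zs \<in> interp parity_structure R \<longleftrightarrow>
    set zs \<subseteq> universe parity_structure \<and> length zs = arity L R \<and> inj_on fst (set zs) \<and>
    (zs = [] \<and> [] \<in> interp E R \<or> odd (card {z \<in> set zs. (R, map fst zs) \<in> snd z}))"
  by (auto simp: parity_structure_def)

text \<open>Taking \<open>S = universe E\<close> leaves only the mark on the first entry of each
  related tuple.\<close>

definition point :: "'a \<Rightarrow> 'a \<times> ('r \<times> 'a list) set" where
  "point x = (x, {(R, xs) \<in> slots x. marked (universe E) R xs x})"

text \<open>Modulo 2, the prescription for \<open>Domain p\<close> is subtracted, the remainder is
  carried along \<open>H p\<close>, and the prescription for \<open>Range p\<close> is
  added.\<close>

definition lift :: "('a \<times> 'a) set \<Rightarrow> 'a \<times> ('r \<times> 'a list) set \<Rightarrow> 'a \<times> ('r \<times> 'a list) set" where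
  "lift p z = (H p (fst z), {(R, map (H p) xs) |R xs. (R, xs) \<in> slots (fst z) \<and>
     ((R, xs) \<in> snd z) \<noteq>
       (marked (Domain p) R xs (fst z) \<noteq> marked (Range p) R (map (H p) xs) (H p (fst z)))})"

lemma fst_lift: "fst (lift p z) = H p (fst z)"
  by (simp add: lift_def)

lemma fst_point: "fst (point x) = x"
  by (simp add: point_def)

section \<open>The lift of a single partial injection\<close>

context
  fixes p
  assumes p: "p \<in> partial_injections (universe E)"
begin

lemma map_in_lists: "xs \<in> lists (universe E) \<Longrightarrow> map (H p) xs \<in> lists (universe E)"
  using maps[OF p] by auto

lemma map_eq_iff:
  assumes "xs \<in> lists (universe E)" "ys \<in> lists (universe E)"
  shows "map (H p) xs = map (H p) ys \<longleftrightarrow> xs = ys"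
proof -
  have "inj_on (H p) (set xs \<union> set ys)"
    using assms by (intro inj_on_subset[OF inj[OF p]]) auto
  then show ?thesis by (metis map_inj_on)
qed

lemma slots_map: "(R, xs) \<in> slots x \<Longrightarrow> (R, map (H p) xs) \<in> slots (H p x)"
  using map_in_lists by (auto simp: slots_def)

lemma slotsE:
  assumes "(R, ys) \<in> slots (H p x)" "x \<in> universe E"
  obtains xs where "ys = map (H p) xs" "(R, xs) \<in> slots x"
proof
  have cp: "p\<inverse> \<in> partial_injections (universe E)" by (rule partial_injections_converse[OF p])
  let ?xs = "map (H (p\<inverse>)) ys"
  have ys: "ys \<in> lists (universe E)" using assms by (simp add: slots_def)
  then show "ys = map (H p) ?xs"
    by (auto intro!: map_idI[symmetric] simp: converse_cancel'[OF p])
  have "x = H (p\<inverse>) (H p x)" using converse_cancel[OF p] assms by simp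
  then have "x \<in> set ?xs" using assms(1) by (auto simp: slots_def)
  then show "(R, ?xs) \<in> slots x"
    using assms ys maps[OF cp] by (auto simp: slots_def)
qed

lemma mem_lift:
  assumes "(R, xs) \<in> slots (fst z)"
  shows "(R, map (H p) xs) \<in> snd (lift p z) \<longleftrightarrow> ((R, xs) \<in> snd z) \<noteq>
    (marked (Domain p) R xs (fst z) \<noteq> marked (Range p) R (map (H p) xs) (H p (fst z)))"
proof -
  have "xs' = xs" if "map (H p) xs' = map (H p) xs" "(R, xs') \<in> slots (fst z)" for xs'
    using that assms map_eq_iff by (auto simp: slots_def)
  then show ?thesis using assms unfolding lift_def by force
qed

lemma snd_lift_subset: "snd (lift p z) \<subseteq> slots (H p (fst z))"
  unfolding lift_def using slots_map by auto

text \<open>The slots at \<open>H p x\<close> are exactly the images of those at \<open>x\<close>,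
  so decorations over \<open>H p x\<close> need only be compared on such images.\<close>

lemma lift_eqI:
  assumes "x \<in> universe E" "A \<subseteq> slots (H p x)" "B \<subseteq> slots (H p x)"
    and "\<And>R xs. (R, xs) \<in> slots x \<Longrightarrow> (R, map (H p) xs) \<in> A \<longleftrightarrow> (R, map (H p) xs) \<in> B"
  shows "A = B"
proof (rule Set.set_eqI)
  fix t :: "'r \<times> 'a list"
  obtain R ys where t: "t = (R, ys)" by (cases t)
  show "t \<in> A \<longleftrightarrow> t \<in> B"
  proof (cases "t \<in> slots (H p x)")
    case True
    then show ?thesis using slotsE[of R ys x] assms(1,4) t by metis
  next
    case False
    then show ?thesis using assms(2,3) by blast
  qed
qed

lemma lift_maps: "z \<in> universe parity_structure \<Longrightarrow> lift p z \<in> universe parity_structure"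
  using snd_lift_subset[of z] maps[OF p] fst_lift[of p z]
  by (auto simp: parity_structure_def mem_Times_iff Sigma_def lift_def)

lemma inj_lift:
  assumes "inj_on fst S" "S \<subseteq> universe parity_structure"
  shows "inj_on (fst \<circ> lift p) S"
proof -
  have "fst ` S \<subseteq> universe E" using assms(2) by (fastforce simp: parity_structure_def)
  then have "inj_on (H p \<circ> fst) S"
    using assms(1) inj[OF p] by (blast intro: comp_inj_on inj_on_subset)
  then show ?thesis by (simp add: comp_def fst_lift)
qed

end

text \<open>For \<open>x\<close> in the domain and \<open>y\<close> in the range, the prescriptions
  for \<open>Domain p\<close> and \<open>Range p\<close> agree with the one for
  \<open>universe E\<close>. The first cancels the decoration of \<open>point x\<close>; the second
  is the decoration of \<open>point y\<close>.\<close>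

lemma lift_point:
  assumes p: "p \<in> iso_graphs L E" and xy: "(x, y) \<in> p"
  shows "lift p (point x) = point y"
proof -
  have pp: "p \<in> partial_injections (universe E)" using p by (rule iso_graphs_partial_injections)
  have x: "x \<in> universe E" "y \<in> universe E" and Hx: "H p x = y"
    using pp xy extends by (auto simp: partial_injections_def)
  have "snd (lift p (point x)) = snd (point y)"
  proof (rule lift_eqI[OF pp x(1)])
    fix R xs assume a: "(R, xs) \<in> slots x"
    have "marked (Domain p) R xs x = marked (universe E) R xs x"
      "marked (Range p) R (map (H p) xs) y = marked (universe E) R (map (H p) xs) y"
      using xy x by (auto simp: marked_def)
    then show "(R, map (H p) xs) \<in> snd (lift p (point x)) \<longleftrightarrow> (R, map (H p) xs) \<in> snd (point y)"
      using mem_lift[OF pp, of R xs "point x"] a slots_map[OF pp a] x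
      by (simp add: fst_point Hx) (simp add: point_def, blast)
  qed (use snd_lift_subset[OF pp, of "point x"] Hx in \<open>auto simp: point_def\<close>)
  then show ?thesis by (simp add: prod_eq_iff fst_lift fst_point Hx)
qed

text \<open>An even number of marks is switched at each tuple. By \<open>odd_marked\<close> the two
  prescriptions contribute oddly exactly when the tuple is nonempty, related and inside the domain,
  respectively when this holds of its image and the range. These conditions agree because
  \<open>p\<close> preserves relations.\<close>

lemma lift_hom:
  assumes p: "p \<in> iso_graphs L E"
  shows "homomorphism L parity_structure parity_structure (lift p)"
  unfolding homomorphism_def
proof (intro conjI ballI)
  have pp: "p \<in> partial_injections (universe E)" using p by (rule iso_graphs_partial_injections)
  show "lift p \<in> universe parity_structure \<rightarrow> universe parity_structure"
    using lift_maps[OF pp] by auto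
  fix R zs
  assume R: "R \<in> symbols L" and zs: "zs \<in> interp parity_structure R"
  let ?xs = "map fst zs" and ?zs = "map (lift p) zs"
  have U: "set zs \<subseteq> universe parity_structure" and len: "length zs = arity L R"
    and i: "inj_on fst (set zs)"
    and par: "zs = [] \<and> [] \<in> interp E R \<or> odd (card {z \<in> set zs. (R, ?xs) \<in> snd z})"
    using zs by (auto simp: interp_parity_structure_iff)
  have xs: "?xs \<in> lists (universe E)" using U by (fastforce simp: parity_structure_def)
  have fst': "map fst ?zs = map (H p) ?xs" by (simp add: fst_lift)
  have i': "inj_on (fst \<circ> lift p) (set zs)" using inj_lift[OF pp i U] .
  have il: "inj_on (lift p) (set zs)" using i' by (rule inj_on_imageI2)
  have slot: "(R, ?xs) \<in> slots (fst z)" if "z \<in> set zs" for z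
    using that R len xs by (auto simp: slots_def)
  let ?P = "\<lambda>x. marked (Domain p) R ?xs x"
  let ?Q = "\<lambda>x. marked (Range p) R (map (H p) ?xs) x"
  have sub: "set ?xs \<subseteq> Domain p \<and> ?xs \<in> interp E R \<longleftrightarrow>
    set (map (H p) ?xs) \<subseteq> Range p \<and> map (H p) ?xs \<in> interp E R"
  proof -
    have "set (map (H p) ?xs) \<subseteq> Range p \<longleftrightarrow> set ?xs \<subseteq> Domain p"
      using mem_Range_iff[OF pp] xs by (force simp: image_subset_iff)
    moreover have "?xs \<in> interp E R \<longleftrightarrow> map (H p) ?xs \<in> interp E R" if "set ?xs \<subseteq> Domain p"
    proof -
      have "list_all2 (\<lambda>x y. (x, y) \<in> p) ?xs (map (H p) ?xs)"
      proof (rule list_all2_all_nthI)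
        fix n assume "n < length ?xs"
        then have "?xs ! n \<in> Domain p" using that nth_mem by blast
        then show "(?xs ! n, map (H p) ?xs ! n) \<in> p"
          using extends[OF pp] \<open>n < length ?xs\<close> by (auto simp del: map_map)
      qed simp
      then show ?thesis using p R by (simp add: iso_graphs_def)
    qed
    ultimately show ?thesis by blast
  qed
  \<comment> \<open>Injectivity of \<open>fst\<close> turns the count over entries of
    \<open>zs\<close> into the count over points to which \<open>odd_marked\<close> applies.\<close>
  have oP: "odd (card {z \<in> set zs. ?P (fst z)}) \<longleftrightarrow> odd (card {x \<in> set ?xs. ?P x})"
  proof -
    have "{x \<in> set ?xs. ?P x} = fst ` {z \<in> set zs. ?P (fst z)}" by auto
    moreover have "inj_on fst {z \<in> set zs. ?P (fst z)}" using i by (rule inj_on_subset) auto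
    ultimately show ?thesis by (simp add: card_image)
  qed
  have oQ: "odd (card {z \<in> set zs. ?Q (H p (fst z))}) \<longleftrightarrow> odd (card {x \<in> set (map (H p) ?xs). ?Q x})"
  proof -
    have "{x \<in> set (map (H p) ?xs). ?Q x} = (fst \<circ> lift p) ` {z \<in> set zs. ?Q (H p (fst z))}"
      by (auto simp: fst_lift)
    moreover have "inj_on (fst \<circ> lift p) {z \<in> set zs. ?Q (H p (fst z))}"
      using i' by (rule inj_on_subset) auto
    ultimately show ?thesis by (simp only: card_image)
  qed
  have "{z \<in> set ?zs. (R, map fst ?zs) \<in> snd z} =
    lift p ` {z \<in> set zs. ((R, ?xs) \<in> snd z) \<noteq> (?P (fst z) \<noteq> ?Q (H p (fst z)))}"
    unfolding fst' using mem_lift[OF pp slot] by auto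
  moreover have "inj_on (lift p) {z \<in> set zs. ((R, ?xs) \<in> snd z) \<noteq> (?P (fst z) \<noteq> ?Q (H p (fst z)))}"
    using il by (rule inj_on_subset) auto
  ultimately have "odd (card {z \<in> set ?zs. (R, map fst ?zs) \<in> snd z}) \<longleftrightarrow>
    odd (card {z \<in> set zs. ((R, ?xs) \<in> snd z) \<noteq> (?P (fst z) \<noteq> ?Q (H p (fst z)))})"
    by (simp add: card_image)
  also have "\<dots> \<longleftrightarrow> odd (card {z \<in> set zs. (R, ?xs) \<in> snd z})"
    using oP oQ sub by (simp only: odd_card_neq finite_set odd_marked) auto
  finally show "?zs \<in> interp parity_structure R"
    unfolding interp_parity_structure_iff
    using par lift_maps[OF pp] U len inj_on_imageI[OF i'] by auto
qed

text \<open>The prescription for \<open>Range p\<close> added by the first lift is the one for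
  \<open>Domain q\<close> removed by the second.\<close>

lemma lift_comp:
  assumes p: "p \<in> partial_injections (universe E)" and q: "q \<in> partial_injections (universe E)"
    and pq: "Range p = Domain q" and z: "z \<in> universe parity_structure"
  shows "lift (p O q) z = lift q (lift p z)"
proof -
  let ?r = "p O q"
  have r: "?r \<in> partial_injections (universe E)"
    using p q by (auto simp: partial_injections_def converse_relcomp intro!: single_valued_relcomp)
  have dom: "Domain ?r = Domain p" "Range ?r = Range q" using pq by blast+
  have x: "fst z \<in> universe E" using z by (auto simp: parity_structure_def)
  have Hr: "H ?r w = H q (H p w)" if "w \<in> universe E" for w using comp[OF p q pq that] .
  have "snd (lift ?r z) = snd (lift q (lift p z))"
  proof (rule lift_eqI[OF r x snd_lift_subset[OF r]])
    show "snd (lift q (lift p z)) \<subseteq> slots (H ?r (fst z))"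
      using snd_lift_subset[OF q, of "lift p z"] Hr[OF x] by (simp add: fst_lift)
    fix R xs assume a: "(R, xs) \<in> slots (fst z)"
    then have m: "map (H ?r) xs = map (H q) (map (H p) xs)"
      using Hr by (auto simp: slots_def)
    have b: "(R, map (H p) xs) \<in> slots (fst (lift p z))"
      using slots_map[OF p a] by (simp add: fst_lift)
    show "(R, map (H ?r) xs) \<in> snd (lift ?r z) \<longleftrightarrow> (R, map (H ?r) xs) \<in> snd (lift q (lift p z))"
      unfolding mem_lift[OF r a] unfolding m mem_lift[OF q b] mem_lift[OF p a]
      by (auto simp: dom fst_lift Hr[OF x] pq)
  qed
  then show ?thesis by (simp add: prod_eq_iff fst_lift Hr[OF x])
qed

lemma lift_ident:
  assumes S: "S \<subseteq> universe E" and z: "z \<in> universe parity_structure"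
  shows "lift (Id_on S) z = z"
proof -
  have p: "Id_on S \<in> partial_injections (universe E)" using S by (auto simp: partial_injections_def)
  have x: "fst z \<in> universe E" "snd z \<subseteq> slots (fst z)"
    using z by (auto simp: parity_structure_def)
  have Hx: "H (Id_on S) (fst z) = fst z" using ident[OF S x(1)] .
  have "snd (lift (Id_on S) z) = snd z"
  proof (rule lift_eqI[OF p x(1) snd_lift_subset[OF p]])
    fix R xs assume a: "(R, xs) \<in> slots (fst z)"
    then have m: "map (H (Id_on S)) xs = xs" using ident[OF S] by (auto simp: slots_def map_idI)
    show "(R, map (H (Id_on S)) xs) \<in> snd (lift (Id_on S) z) \<longleftrightarrow> (R, map (H (Id_on S)) xs) \<in> snd z"
      unfolding mem_lift[OF p a] unfolding m by (simp add: Hx)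
  qed (use x Hx in simp)
  then show ?thesis by (simp add: prod_eq_iff fst_lift Hx)
qed

lemma finite_slots: "finite (slots x)"
proof -
  have "slots x \<subseteq> (SIGMA R:symbols L. {xs. set xs \<subseteq> universe E \<and> length xs = arity L R})"
    by (auto simp: slots_def)
  moreover have "finite (SIGMA R:symbols L. {xs. set xs \<subseteq> universe E \<and> length xs = arity L R})"
    using fin fin_symbols by (auto simp: finite_structure_def intro!: finite_lists_length_eq)
  ultimately show ?thesis by (rule finite_subset)
qed

text \<open>The marks on a tuple of embedded points are those counted by \<open>odd_marked\<close>
  with \<open>S = universe E\<close>, so for nonempty tuples an odd count means that the tuple is
  related.\<close>

lemma point_embedding: "embedding L E parity_structure point"
  unfolding embedding_def
proof (intro conjI ballI)
  show "inj_on point (universe E)" by (metis fst_point inj_onI)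
  show img: "point ` universe E \<subseteq> universe parity_structure"
    by (auto simp: parity_structure_def point_def)
  fix R xs assume R: "R \<in> symbols L" and xs: "xs \<in> lists (universe E)"
  have len: "xs \<in> interp E R \<Longrightarrow> length xs = arity L R" using struct R by (auto simp: is_structure_def)
  have "odd (card {z \<in> set (map point xs). (R, map fst (map point xs)) \<in> snd z}) \<longleftrightarrow>
    xs \<noteq> [] \<and> xs \<in> interp E R" if "length xs = arity L R"
  proof -
    have "{z \<in> set (map point xs). (R, map fst (map point xs)) \<in> snd z} =
      point ` {x \<in> set xs. marked (universe E) R xs x}"
      using R xs that by (auto simp: point_def slots_def comp_def)
    moreover have "inj_on point {x \<in> set xs. marked (universe E) R xs x}"
      by (metis fst_point inj_onI)
    ultimately have "odd (card {z \<in> set (map point xs). (R, map fst (map point xs)) \<in> snd z}) \<longleftrightarrow>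
      odd (card {x \<in> set xs. marked (universe E) R xs x})"
      by (simp add: card_image)
    then show ?thesis using odd_marked[of xs "universe E" R] xs by auto
  qed
  moreover have "inj_on fst (set (map point xs))"
    by (auto simp: inj_on_def fst_point)
  moreover have "set (map point xs) \<subseteq> universe parity_structure" using img xs by auto
  ultimately show "xs \<in> interp E R \<longleftrightarrow> map point xs \<in> interp parity_structure R"
    using len unfolding interp_parity_structure_iff by (cases "xs = []") auto
qed

sublocale parity: coherent_extension L E parity_structure point lift
proof unfold_locales
  show "is_structure L parity_structure"
    by (auto simp: is_structure_def parity_structure_def)
  show "finite_structure parity_structure"
    using fin finite_slots by (auto simp: finite_structure_def parity_structure_def)
qed (auto intro: point_embedding lift_hom lift_point lift_comp lift_ident iso_graphs_partial_injections)

end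


section \<open>Removing homomorphic images of forbidden cliques\<close>

text \<open>Only vertex sets are recorded: these are what the maps \<open>\<Phi> p\<close> permute
  and what the values are attached to.\<close>

definition forbidden_images ::
  "'r language \<Rightarrow> ('t, 'r) rel_structure set \<Rightarrow> ('b, 'r) rel_structure \<Rightarrow> 'b set set" where
  "forbidden_images L \<T> B = {h ` universe T |T h. T \<in> \<T> \<and> homomorphism L T B h}"

lemma homomorphism_comp:
  "homomorphism L A B f \<Longrightarrow> homomorphism L B C g \<Longrightarrow> homomorphism L A C (g \<circ> f)"
  unfolding homomorphism_def by (auto simp: map_map[symmetric] simp del: map_map)

text \<open>Pulling back along \<open>\<iota>\<close> shows that no forbidden image lies inside an
  embedded copy of a free structure. This serves both the copy of \<open>E\<close> in the parity
  structure and the two factors of the amalgam.\<close>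

lemma homomorphism_into_embedding:
  assumes e: "embedding L E B \<iota>" and T: "is_structure L T"
    and h: "homomorphism L T B h" and sub: "h ` universe T \<subseteq> \<iota> ` universe E"
  shows "homomorphism L T E (inv_into (universe E) \<iota> \<circ> h)"
  unfolding homomorphism_def
proof (intro conjI ballI)
  let ?g = "inv_into (universe E) \<iota>"
  have g: "?g (h u) \<in> universe E" if "u \<in> universe T" for u
    using sub that by (auto intro!: inv_into_into dest: subsetD[OF sub, OF imageI])
  then show "?g \<circ> h \<in> universe T \<rightarrow> universe E" by simp
  fix R xs assume R: "R \<in> symbols L" and xs: "xs \<in> interp T R"
  have sx: "set xs \<subseteq> universe T" using T R xs by (auto simp: is_structure_def)
  then have "map \<iota> (map (?g \<circ> h) xs) = map h xs"
    using sub by (auto simp: f_inv_into_f image_subset_iff subset_iff)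
  moreover have "map (?g \<circ> h) xs \<in> lists (universe E)" using sx g by (auto simp: subset_iff)
  ultimately show "map (?g \<circ> h) xs \<in> interp E R"
    using e h R xs unfolding embedding_def homomorphism_def by metis
qed

text \<open>\<open>col I\<close> gives the points of \<open>E\<close> inside \<open>I\<close>
  distinct values, with one value fewer available than \<open>I\<close> has points.
  \<open>K n\<close> depends on the number of values only, so it can relate the values at
  \<open>I\<close> to those at the image of \<open>I\<close> under \<open>\<Phi> p\<close>.\<close>

locale clique_free_extension = coherent_extension L E B \<iota> \<Phi>
  for L :: "'r language" and E :: "('a, 'r) rel_structure" and B :: "('b, 'r) rel_structure"
    and \<iota> :: "'a \<Rightarrow> 'b" and \<Phi> :: "('a \<times> 'a) set \<Rightarrow> 'b \<Rightarrow> 'b" +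
  fixes \<T> :: "('t, 'r) rel_structure set" and col :: "'b set \<Rightarrow> 'a \<Rightarrow> nat"
    and K :: "nat \<Rightarrow> (nat \<times> nat) set \<Rightarrow> nat \<Rightarrow> nat"
  assumes K: "functorial_extension {..<n} (K n)"
    and col_inj: "I \<in> forbidden_images L \<T> B \<Longrightarrow> inj_on (col I) {x \<in> universe E. \<iota> x \<in> I}"
    and col_less: "I \<in> forbidden_images L \<T> B \<Longrightarrow> x \<in> universe E \<Longrightarrow> \<iota> x \<in> I \<Longrightarrow> col I x < card I - 1"
begin

abbreviation (input) bad :: "'b set set" where "bad \<equiv> forbidden_images L \<T> B"

definition generic :: "'b \<times> ('b set \<Rightarrow> nat) \<Rightarrow> 'b \<times> ('b set \<Rightarrow> nat) \<Rightarrow> bool" where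
  "generic z z' \<longleftrightarrow> fst z \<noteq> fst z' \<and>
     (\<forall>I\<in>bad. fst z \<in> I \<longrightarrow> fst z' \<in> I \<longrightarrow> snd z I \<noteq> snd z' I)"

text \<open>Extensional value functions keep the structure finite. A singleton \<open>I\<close> in
  \<open>bad\<close> offers no values, so no point lies over its element.\<close>

definition free_structure :: "('b \<times> ('b set \<Rightarrow> nat), 'r) rel_structure" where
  "free_structure = \<lparr>universe = (SIGMA b:universe B. \<Pi>\<^sub>E I\<in>{I \<in> bad. b \<in> I}. {..<card I - 1}),
     interp = (\<lambda>R. {zs \<in> lists (SIGMA b:universe B. \<Pi>\<^sub>E I\<in>{I \<in> bad. b \<in> I}. {..<card I - 1}).
       map fst zs \<in> interp B R \<and> (\<forall>z\<in>set zs. \<forall>z'\<in>set zs. z \<noteq> z' \<longrightarrow> generic z z')})\<rparr>"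

lemma mem_free_structure_iff:
  "z \<in> universe free_structure \<longleftrightarrow> fst z \<in> universe B \<and>
    snd z \<in> extensional {I \<in> bad. fst z \<in> I} \<and> (\<forall>I\<in>bad. fst z \<in> I \<longrightarrow> snd z I < card I - 1)"
  by (cases z) (auto simp: free_structure_def PiE_iff)

lemma interp_free_structure_iff:
  "zs \<in> interp free_structure R \<longleftrightarrow> set zs \<subseteq> universe free_structure \<and>
    map fst zs \<in> interp B R \<and> (\<forall>z\<in>set zs. \<forall>z'\<in>set zs. z \<noteq> z' \<longrightarrow> generic z z')"
  by (auto simp: free_structure_def)

text \<open>A point of \<open>E\<close> in \<open>I\<close> must exchange its value at
  \<open>I\<close> for the value of its partner under \<open>p\<close> at the image of
  \<open>I\<close>. These demands form a partial injection of values, which \<open>perm\<close>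
  extends.\<close>

definition trace :: "('a \<times> 'a) set \<Rightarrow> 'b set \<Rightarrow> (nat \<times> nat) set" where
  "trace p I = {(col I x, col (\<Phi> p ` I) y) |x y. (x, y) \<in> p \<and> \<iota> x \<in> I}"

definition perm :: "('a \<times> 'a) set \<Rightarrow> 'b set \<Rightarrow> nat \<Rightarrow> nat" where
  "perm p I = K (card I - 1) (trace p I)"

definition point :: "'a \<Rightarrow> 'b \<times> ('b set \<Rightarrow> nat)" where
  "point x = (\<iota> x, \<lambda>I\<in>{I \<in> bad. \<iota> x \<in> I}. col I x)"

definition lift :: "('a \<times> 'a) set \<Rightarrow> 'b \<times> ('b set \<Rightarrow> nat) \<Rightarrow> 'b \<times> ('b set \<Rightarrow> nat)" where
  "lift p z = (\<Phi> p (fst z), \<lambda>J\<in>{J \<in> bad. \<Phi> p (fst z) \<in> J}.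
     perm p (\<Phi> (p\<inverse>) ` J) (snd z (\<Phi> (p\<inverse>) ` J)))"

lemma fst_lift: "fst (lift p z) = \<Phi> p (fst z)"
  by (simp add: lift_def)

lemma fst_point: "fst (point x) = \<iota> x"
  by (simp add: point_def)

lemma bad_subset: "I \<in> bad \<Longrightarrow> I \<subseteq> universe B"
  unfolding forbidden_images_def homomorphism_def by auto

lemma finite_bad: "finite bad"
  using bad_subset fin by (intro finite_subset[of bad "Pow (universe B)"]) (auto simp: finite_structure_def)

section \<open>Action of one partial isomorphism on forbidden images and values\<close>

context
  fixes p
  assumes p: "p \<in> iso_graphs L E"
begin

lemma mem_universe: "(x, y) \<in> p \<Longrightarrow> x \<in> universe E \<and> y \<in> universe E"
  using iso_graphs_Domain_Range[OF p] by auto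

lemma bad_image:
  assumes "I \<in> bad"
  shows "\<Phi> p ` I \<in> bad"
proof -
  obtain T h where T: "T \<in> \<T>" "homomorphism L T B h" "I = h ` universe T"
    using assms unfolding forbidden_images_def by blast
  then have "\<Phi> p ` I = (\<Phi> p \<circ> h) ` universe T" by (simp add: image_comp)
  then show ?thesis
    using T(1) homomorphism_comp[OF T(2) hom[OF p]] unfolding forbidden_images_def by blast
qed

lemma card_image_bad: "I \<in> bad \<Longrightarrow> card (\<Phi> p ` I) = card I"
  using bij[OF p] bad_subset by (meson bij_betw_def card_image inj_on_subset)

lemma mem_image_iff: "I \<in> bad \<Longrightarrow> b \<in> universe B \<Longrightarrow> \<Phi> p b \<in> \<Phi> p ` I \<longleftrightarrow> b \<in> I"
  using bij[OF p] bad_subset by (meson bij_betw_def inj_on_image_mem_iff)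

lemma converse_image: "I \<in> bad \<Longrightarrow> \<Phi> (p\<inverse>) ` \<Phi> p ` I = I"
  using converse_cancel[OF p] bad_subset by (force simp: image_comp)

lemma embed_mem_image:
  assumes "(x, y) \<in> p" "I \<in> bad"
  shows "\<iota> y \<in> \<Phi> p ` I \<longleftrightarrow> \<iota> x \<in> I"
proof -
  have "\<iota> x \<in> universe B" using mem_universe[OF assms(1)] emb by (auto simp: embedding_def)
  then show ?thesis using mem_image_iff[OF assms(2)] extends[OF p assms(1)] by metis
qed

lemma col_eq_iff:
  "I \<in> bad \<Longrightarrow> x \<in> universe E \<Longrightarrow> x' \<in> universe E \<Longrightarrow> \<iota> x \<in> I \<Longrightarrow> \<iota> x' \<in> I \<Longrightarrow>
    col I x = col I x' \<longleftrightarrow> x = x'"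
  using col_inj[of I] by (auto simp: inj_on_def)

text \<open>Both \<open>p\<close> and \<open>col\<close> are injective on the points concerned, and
  partners under \<open>p\<close> lie in \<open>I\<close> and in its image simultaneously. The image
  has the same size as \<open>I\<close>, so the bound on the values is the same.\<close>

lemma trace_partial_injection:
  assumes I: "I \<in> bad"
  shows "trace p I \<in> partial_injections {..<card I - 1}"
proof -
  have sv: "single_valued p" "single_valued (p\<inverse>)"
    using p by (auto simp: iso_graphs_def partial_injections_def)
  have "trace p I \<subseteq> {..<card I - 1} \<times> {..<card I - 1}"
    using col_less[OF I] col_less[OF bad_image[OF I]] mem_universe embed_mem_image[OF _ I]
    by (auto simp: trace_def card_image_bad[OF I])
  moreover have "single_valued (trace p I)"
  proof (rule single_valuedI)
    fix a b c assume "(a, b) \<in> trace p I" "(a, c) \<in> trace p I"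
    then obtain x y x' y' where xy: "(x, y) \<in> p" "(x', y') \<in> p" "\<iota> x \<in> I" "\<iota> x' \<in> I"
      "a = col I x" "b = col (\<Phi> p ` I) y" "a = col I x'" "c = col (\<Phi> p ` I) y'"
      unfolding trace_def by blast
    then have "x = x'" using col_eq_iff[OF I] mem_universe by metis
    then show "b = c" using xy sv by (metis single_valuedD)
  qed
  moreover have "single_valued ((trace p I)\<inverse>)"
  proof (rule single_valuedI)
    fix a b c assume "(a, b) \<in> (trace p I)\<inverse>" "(a, c) \<in> (trace p I)\<inverse>"
    then obtain x y x' y' where xy: "(x, y) \<in> p" "(x', y') \<in> p" "\<iota> x \<in> I" "\<iota> x' \<in> I"
      "b = col I x" "a = col (\<Phi> p ` I) y" "c = col I x'" "a = col (\<Phi> p ` I) y'"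
      unfolding trace_def by blast
    then have "y = y'"
      using col_eq_iff[OF bad_image[OF I]] mem_universe embed_mem_image[OF _ I] by metis
    then show "b = c" using xy sv by (metis single_valuedD converseI)
  qed
  ultimately show ?thesis by (simp add: partial_injections_def)
qed

lemma perm_less: "I \<in> bad \<Longrightarrow> i < card I - 1 \<Longrightarrow> perm p I i < card I - 1"
  using functorial_extension.maps[OF K trace_partial_injection] by (auto simp: perm_def)

lemma perm_col: "I \<in> bad \<Longrightarrow> (x, y) \<in> p \<Longrightarrow> \<iota> x \<in> I \<Longrightarrow> perm p I (col I x) = col (\<Phi> p ` I) y"
  unfolding perm_def by (rule functorial_extension.extends[OF K trace_partial_injection])
    (auto simp: trace_def)

lemma inj_perm: "I \<in> bad \<Longrightarrow> inj_on (perm p I) {..<card I - 1}"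
  unfolding perm_def by (rule functorial_extension.inj[OF K trace_partial_injection])

lemma snd_lift:
  assumes "I \<in> bad" "fst z \<in> I"
  shows "snd (lift p z) (\<Phi> p ` I) = perm p I (snd z I)"
  using bad_image[OF assms(1)] converse_image[OF assms(1)] assms(2) by (simp add: lift_def)

end

lemma bad_imageE:
  assumes p: "p \<in> iso_graphs L E" and J: "J \<in> bad"
  obtains I where "I \<in> bad" "J = \<Phi> p ` I"
proof
  have cp: "p\<inverse> \<in> iso_graphs L E" by (rule iso_graphs_converse[OF p])
  show "\<Phi> (p\<inverse>) ` J \<in> bad" by (rule bad_image[OF cp J])
  show "J = \<Phi> p ` \<Phi> (p\<inverse>) ` J" using converse_image[OF cp J] by simp
qed

lemma lift_eqI:
  assumes p: "p \<in> iso_graphs L E" and b: "b \<in> universe B"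
    and ext: "f \<in> extensional {J \<in> bad. \<Phi> p b \<in> J}" "g \<in> extensional {J \<in> bad. \<Phi> p b \<in> J}"
    and eq: "\<And>I. I \<in> bad \<Longrightarrow> b \<in> I \<Longrightarrow> f (\<Phi> p ` I) = g (\<Phi> p ` I)"
  shows "f = g"
proof (rule extensionalityI[OF ext])
  fix J assume J: "J \<in> {J \<in> bad. \<Phi> p b \<in> J}"
  then obtain I where I: "I \<in> bad" "J = \<Phi> p ` I" using bad_imageE[OF p] by auto
  then show "f J = g J" using eq mem_image_iff[OF p I(1) b] J by auto
qed

lemma lift_extensional: "snd (lift p z) \<in> extensional {J \<in> bad. \<Phi> p (fst z) \<in> J}"
  by (simp add: lift_def)

lemma lift_maps:
  assumes p: "p \<in> iso_graphs L E" and z: "z \<in> universe free_structure"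
  shows "lift p z \<in> universe free_structure"
proof -
  have b: "fst z \<in> universe B" using z by (simp add: mem_free_structure_iff)
  have "snd (lift p z) J < card J - 1" if J: "J \<in> bad" "\<Phi> p (fst z) \<in> J" for J
  proof -
    obtain I where I: "I \<in> bad" "J = \<Phi> p ` I" using bad_imageE[OF p J(1)] by auto
    then have "fst z \<in> I" using mem_image_iff[OF p I(1) b] J by auto
    then show ?thesis
      using snd_lift[OF p I(1)] perm_less[OF p I(1)] z I card_image_bad[OF p I(1)]
      by (simp add: mem_free_structure_iff)
  qed
  then show ?thesis
    using lift_extensional[of p z] maps[OF p b] by (simp add: mem_free_structure_iff fst_lift)
qed

lemma lift_point:
  assumes p: "p \<in> iso_graphs L E" and xy: "(x, y) \<in> p"
  shows "lift p (point x) = point y"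
proof -
  have x: "\<iota> x \<in> universe B" using mem_universe[OF p xy] emb by (auto simp: embedding_def)
  have y: "\<Phi> p (\<iota> x) = \<iota> y" by (rule extends[OF p xy])
  have "snd (lift p (point x)) = snd (point y)"
  proof (rule lift_eqI[OF p x])
    fix I assume I: "I \<in> bad" "\<iota> x \<in> I"
    have "snd (lift p (point x)) (\<Phi> p ` I) = perm p I (col I x)"
      using snd_lift[OF p I(1), of "point x"] I by (simp add: fst_point) (simp add: point_def)
    also have "\<dots> = snd (point y) (\<Phi> p ` I)"
      using perm_col[OF p I(1) xy I(2)] embed_mem_image[OF p xy I(1)] I bad_image[OF p I(1)]
      by (simp add: point_def)
    finally show "snd (lift p (point x)) (\<Phi> p ` I) = snd (point y) (\<Phi> p ` I)" .
  qed (use lift_extensional[of p "point x"] in \<open>simp_all add: fst_point y, simp add: point_def\<close>)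
  then show ?thesis by (simp add: prod_eq_iff fst_lift fst_point y)
qed

text \<open>The values at \<open>I\<close> of all points are moved by one permutation
  \<open>perm p I\<close>, so distinct values stay distinct.\<close>

lemma lift_hom:
  assumes p: "p \<in> iso_graphs L E"
  shows "homomorphism L free_structure free_structure (lift p)"
  unfolding homomorphism_def
proof (intro conjI ballI)
  show "lift p \<in> universe free_structure \<rightarrow> universe free_structure"
    using lift_maps[OF p] by auto
  fix R zs
  assume R: "R \<in> symbols L" and "zs \<in> interp free_structure R"
  then have U: "set zs \<subseteq> universe free_structure" and B: "map fst zs \<in> interp B R"
    and gen: "\<And>z z'. z \<in> set zs \<Longrightarrow> z' \<in> set zs \<Longrightarrow> z \<noteq> z' \<Longrightarrow> generic z z'"
    by (auto simp: interp_free_structure_iff)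
  have "generic (lift p z) (lift p z')" if "z \<in> set zs" "z' \<in> set zs" "z \<noteq> z'" for z z'
    unfolding generic_def
  proof (intro conjI ballI impI)
    have g: "generic z z'" and b: "fst z \<in> universe B" "fst z' \<in> universe B"
      using gen that U by (auto simp: mem_free_structure_iff)
    then show "fst (lift p z) \<noteq> fst (lift p z')"
      using bij[OF p] by (auto simp: fst_lift generic_def bij_betw_def inj_on_def)
    fix J assume J: "J \<in> bad" "fst (lift p z) \<in> J" "fst (lift p z') \<in> J"
    obtain I where I: "I \<in> bad" "J = \<Phi> p ` I" using bad_imageE[OF p J(1)] by auto
    then have zI: "fst z \<in> I" "fst z' \<in> I"
      using mem_image_iff[OF p I(1)] J b by (auto simp: fst_lift)
    then have "snd z I \<noteq> snd z' I" "snd z I < card I - 1" "snd z' I < card I - 1"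
      using g I that U by (auto simp: generic_def mem_free_structure_iff)
    then show "snd (lift p z) J \<noteq> snd (lift p z') J"
      using inj_perm[OF p I(1)] zI I(2) snd_lift[OF p I(1)] by (auto simp: inj_on_def)
  qed
  moreover have "map fst (map (lift p) zs) = map (\<Phi> p) (map fst zs)" by (simp add: fst_lift)
  then have "map fst (map (lift p) zs) \<in> interp B R"
    using hom[OF p] R B unfolding homomorphism_def by metis
  ultimately show "map (lift p) zs \<in> interp free_structure R"
    using U lift_maps[OF p] unfolding interp_free_structure_iff by auto
qed

lemma relcomp_iso_graphs:
  assumes p: "p \<in> iso_graphs L E" and q: "q \<in> iso_graphs L E"
  shows "p O q \<in> iso_graphs L E"
proof -
  have "xs \<in> interp E R \<longleftrightarrow> ys \<in> interp E R"
    if R: "R \<in> symbols L" and l: "list_all2 (\<lambda>x y. (x, y) \<in> p O q) xs ys" for R xs ys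
  proof -
    have "list_all2 ((\<lambda>x y. (x, y) \<in> p) OO (\<lambda>x y. (x, y) \<in> q)) xs ys"
      using l by (rule list_all2_mono) auto
    then show ?thesis using p q R by (auto simp: list.rel_compp iso_graphs_def)
  qed
  then show ?thesis
    using p q by (auto simp: iso_graphs_def partial_injections_def converse_relcomp
      intro!: single_valued_relcomp)
qed

text \<open>\<open>K\<close> is functorial on composable injections, so the traces must be
  composable as well. Equal values at the intermediate image come from equal points because
  \<open>col\<close> is injective there, and \<open>Range p = Domain q\<close> makes range and
  domain of the traces match.\<close>

lemma trace_relcomp:
  assumes p: "p \<in> iso_graphs L E" and q: "q \<in> iso_graphs L E" and pq: "Range p = Domain q"
    and I: "I \<in> bad"
  shows "trace (p O q) I = trace p I O trace q (\<Phi> p ` I)"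
    and "Range (trace p I) = Domain (trace q (\<Phi> p ` I))"
proof -
  have im: "\<Phi> (p O q) ` I = \<Phi> q ` \<Phi> p ` I"
    using comp[OF p q pq] bad_subset[OF I] by (force simp: image_comp)
  have mid: "y = y'" if "(x, y) \<in> p" "\<iota> x \<in> I" "(y', z) \<in> q" "\<iota> y' \<in> \<Phi> p ` I"
    "col (\<Phi> p ` I) y = col (\<Phi> p ` I) y'" for x y y' z
    using col_eq_iff[OF p bad_image[OF p I]] that mem_universe[OF p] mem_universe[OF q]
      embed_mem_image[OF p _ I] by metis
  show "trace (p O q) I = trace p I O trace q (\<Phi> p ` I)" (is "?l = ?r")
  proof
    show "?l \<subseteq> ?r"
    proof (rule subrelI)
      fix a c assume "(a, c) \<in> ?l"
      then obtain x y z where "(x, y) \<in> p" "(y, z) \<in> q" "\<iota> x \<in> I" "a = col I x"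
        "c = col (\<Phi> q ` \<Phi> p ` I) z"
        unfolding trace_def im by blast
      moreover from this have "\<iota> y \<in> \<Phi> p ` I" using embed_mem_image[OF p _ I] by simp
      ultimately show "(a, c) \<in> ?r" unfolding trace_def by blast
    qed
    show "?r \<subseteq> ?l"
    proof (rule subrelI)
      fix a c assume "(a, c) \<in> ?r"
      then obtain x y y' z where *: "(x, y) \<in> p" "\<iota> x \<in> I" "(y', z) \<in> q" "\<iota> y' \<in> \<Phi> p ` I"
        "col (\<Phi> p ` I) y = col (\<Phi> p ` I) y'" "a = col I x" "c = col (\<Phi> q ` \<Phi> p ` I) z"
        unfolding trace_def by blast
      then have "(x, z) \<in> p O q" using mid by blast
      then show "(a, c) \<in> ?l" using * unfolding trace_def im by blast
    qed
  qed
  show "Range (trace p I) = Domain (trace q (\<Phi> p ` I))"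
  proof
    show "Range (trace p I) \<subseteq> Domain (trace q (\<Phi> p ` I))"
    proof
      fix a assume "a \<in> Range (trace p I)"
      then obtain x y where "(x, y) \<in> p" "\<iota> x \<in> I" "a = col (\<Phi> p ` I) y"
        unfolding trace_def by blast
      moreover from this have "\<iota> y \<in> \<Phi> p ` I" using embed_mem_image[OF p _ I] by simp
      moreover obtain z where "(y, z) \<in> q" using calculation pq by blast
      ultimately show "a \<in> Domain (trace q (\<Phi> p ` I))" unfolding trace_def by blast
    qed
    show "Domain (trace q (\<Phi> p ` I)) \<subseteq> Range (trace p I)"
    proof
      fix a assume "a \<in> Domain (trace q (\<Phi> p ` I))"
      then obtain y z where "(y, z) \<in> q" "\<iota> y \<in> \<Phi> p ` I" "a = col (\<Phi> p ` I) y"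
        unfolding trace_def by blast
      moreover obtain x where "(x, y) \<in> p" using calculation pq by blast
      moreover from this have "\<iota> x \<in> I" using calculation embed_mem_image[OF p _ I] by simp
      ultimately show "a \<in> Range (trace p I)" unfolding trace_def by blast
    qed
  qed
qed

lemma lift_comp:
  assumes p: "p \<in> iso_graphs L E" and q: "q \<in> iso_graphs L E" and pq: "Range p = Domain q"
    and z: "z \<in> universe free_structure"
  shows "lift (p O q) z = lift q (lift p z)"
proof -
  have r: "p O q \<in> iso_graphs L E" by (rule relcomp_iso_graphs[OF p q])
  have b: "fst z \<in> universe B" using z by (simp add: mem_free_structure_iff)
  have c: "\<Phi> (p O q) (fst z) = \<Phi> q (\<Phi> p (fst z))" by (rule comp[OF p q pq b])
  have "snd (lift (p O q) z) = snd (lift q (lift p z))"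
  proof (rule lift_eqI[OF r b lift_extensional])
    show "snd (lift q (lift p z)) \<in> extensional {J \<in> bad. \<Phi> (p O q) (fst z) \<in> J}"
      using lift_extensional[of q "lift p z"] by (simp add: c fst_lift)
    fix I assume I: "I \<in> bad" "fst z \<in> I"
    let ?n = "card I - 1"
    have J: "\<Phi> p ` I \<in> bad" "fst (lift p z) \<in> \<Phi> p ` I"
      using bad_image[OF p I(1)] I by (auto simp: fst_lift)
    have im: "\<Phi> (p O q) ` I = \<Phi> q ` \<Phi> p ` I"
      using comp[OF p q pq] bad_subset[OF I(1)] by (force simp: image_comp)
    \<comment> \<open>Equal size means that both permutations come from the same
      \<open>K ?n\<close>, whose functoriality then applies.\<close>
    have n: "card (\<Phi> p ` I) = card I" by (rule card_image_bad[OF p I(1)])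
    have "snd (lift (p O q) z) (\<Phi> (p O q) ` I) = perm (p O q) I (snd z I)"
      by (rule snd_lift[OF r I])
    also have "\<dots> = perm q (\<Phi> p ` I) (perm p I (snd z I))"
      unfolding perm_def trace_relcomp(1)[OF p q pq I(1)] n
    proof (rule functorial_extension.comp[OF K])
      show "trace p I \<in> partial_injections {..<?n}" by (rule trace_partial_injection[OF p I(1)])
      show "trace q (\<Phi> p ` I) \<in> partial_injections {..<?n}"
        using trace_partial_injection[OF q J(1)] n by simp
      show "snd z I \<in> {..<?n}" using z I by (simp add: mem_free_structure_iff)
    qed (rule trace_relcomp(2)[OF p q pq I(1)])
    also have "\<dots> = snd (lift q (lift p z)) (\<Phi> q ` \<Phi> p ` I)"
      using snd_lift[OF q J] snd_lift[OF p I] by simp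
    finally show "snd (lift (p O q) z) (\<Phi> (p O q) ` I) = snd (lift q (lift p z)) (\<Phi> (p O q) ` I)"
      by (simp add: im)
  qed
  then show ?thesis by (simp add: prod_eq_iff fst_lift c)
qed

lemma lift_ident:
  assumes S: "S \<subseteq> universe E" and z: "z \<in> universe free_structure"
  shows "lift (Id_on S) z = z"
proof -
  have p: "Id_on S \<in> iso_graphs L E" by (rule iso_graphs_Id_on[OF S])
  have b: "fst z \<in> universe B" using z by (simp add: mem_free_structure_iff)
  have "snd (lift (Id_on S) z) = snd z"
  proof (rule lift_eqI[OF p b lift_extensional])
    show "snd z \<in> extensional {J \<in> bad. \<Phi> (Id_on S) (fst z) \<in> J}"
      using z by (simp add: ident[OF S b] mem_free_structure_iff)
    fix I assume I: "I \<in> bad" "fst z \<in> I"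
    have im: "\<Phi> (Id_on S) ` I = I" using ident[OF S] bad_subset[OF I(1)] by force
    let ?C = "col I ` {x \<in> S. \<iota> x \<in> I}"
    have "trace (Id_on S) I = Id_on ?C" by (auto simp: trace_def im)
    moreover have "?C \<subseteq> {..<card I - 1}" using col_less[OF I(1)] S by auto
    ultimately have "perm (Id_on S) I (snd z I) = snd z I"
      using functorial_extension.ident[OF K] z I by (simp add: perm_def mem_free_structure_iff)
    then show "snd (lift (Id_on S) z) (\<Phi> (Id_on S) ` I) = snd z (\<Phi> (Id_on S) ` I)"
      using snd_lift[OF p I] im by simp
  qed
  then show ?thesis by (simp add: prod_eq_iff fst_lift ident[OF S b])
qed

text \<open>Distinct points of the copy differ at every common forbidden image, since
  \<open>col\<close> is injective there. Hence no tuple of the copy is discarded.\<close>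

lemma point_embedding: "embedding L E free_structure point"
  unfolding embedding_def
proof (intro conjI ballI)
  have inj: "inj_on \<iota> (universe E)" using emb by (simp add: embedding_def)
  then show "inj_on point (universe E)" by (metis (mono_tags, lifting) fst_point inj_on_def)
  show img: "point ` universe E \<subseteq> universe free_structure"
    using emb col_less by (auto simp: mem_free_structure_iff point_def embedding_def)
  fix R xs assume R: "R \<in> symbols L" and xs: "xs \<in> lists (universe E)"
  have "generic (point x) (point y)" if "x \<in> universe E" "y \<in> universe E" "point x \<noteq> point y" for x y
  proof -
    have "x \<noteq> y" "\<iota> x \<noteq> \<iota> y" using that inj by (auto simp: inj_on_def)
    then show ?thesis using that col_inj by (auto simp: generic_def point_def inj_on_def)
  qed
  then have "\<forall>z\<in>set (map point xs). \<forall>z'\<in>set (map point xs). z \<noteq> z' \<longrightarrow> generic z z'"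
    using xs by auto
  moreover have "set (map point xs) \<subseteq> universe free_structure" using img xs by auto
  moreover have eq: "map fst (map point xs) = map \<iota> xs" by (simp add: fst_point)
  ultimately have "map point xs \<in> interp free_structure R \<longleftrightarrow> map \<iota> xs \<in> interp B R"
    unfolding interp_free_structure_iff eq by blast
  then show "xs \<in> interp E R \<longleftrightarrow> map point xs \<in> interp free_structure R"
    using emb R xs by (simp add: embedding_def)
qed

sublocale free: coherent_extension L E free_structure point lift
proof unfold_locales
  show "is_structure L free_structure"
    using struct by (fastforce simp: is_structure_def interp_free_structure_iff)
  have "finite (SIGMA b:universe B. \<Pi>\<^sub>E I\<in>{I \<in> bad. b \<in> I}. {..<card I - 1})"
    using fin finite_bad by (auto simp: finite_structure_def intro!: finite_SigmaI finite_PiE)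
  then show "finite_structure free_structure"
    by (simp add: finite_structure_def free_structure_def)
qed (auto intro: point_embedding lift_hom lift_point lift_comp lift_ident)

text \<open>In the image \<open>I\<close> of a clique any two points occur in a common tuple, so they would need
  distinct values at \<open>I\<close>; there is one value too few.\<close>

lemma free:
  assumes T: "\<And>T. T \<in> \<T> \<Longrightarrow> is_structure L T \<and> finite_structure T \<and> gaifman_clique L T"
    and ne: "{} \<notin> bad"
  shows "is_free L \<T> free_structure"
  unfolding is_free_def
proof safe
  fix T h assume "T \<in> \<T>" and h: "homomorphism L T free_structure h"
  then have T: "is_structure L T" "finite_structure T" "gaifman_clique L T" using T by auto
  have hU: "h u \<in> universe free_structure" if "u \<in> universe T" for u
    using h that by (auto simp: homomorphism_def)
  let ?I = "(fst \<circ> h) ` universe T"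
  have "homomorphism L T B (fst \<circ> h)"
    using h hU unfolding homomorphism_def interp_free_structure_iff mem_free_structure_iff by auto
  then have I: "?I \<in> bad" using \<open>T \<in> \<T>\<close> unfolding forbidden_images_def by blast
  have gen: "generic (h u) (h v)" if uv: "u \<in> universe T" "v \<in> universe T" "h u \<noteq> h v" for u v
  proof -
    obtain R cs where "R \<in> symbols L" "cs \<in> interp T R" "u \<in> set cs" "v \<in> set cs"
      using T(3) uv unfolding gaifman_clique_def by blast
    then have "map h cs \<in> interp free_structure R" "h u \<in> set (map h cs)" "h v \<in> set (map h cs)"
      using h unfolding homomorphism_def by auto
    then show ?thesis using uv(3) unfolding interp_free_structure_iff by blast
  qed
  have "inj_on (\<lambda>z. snd z ?I) (h ` universe T)"
  proof (rule inj_onI)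
    fix z z' assume zz: "z \<in> h ` universe T" "z' \<in> h ` universe T" "snd z ?I = snd z' ?I"
    then obtain u v where uv: "u \<in> universe T" "v \<in> universe T" "z = h u" "z' = h v" by blast
    then have "fst z \<in> ?I" "fst z' \<in> ?I" by auto
    then show "z = z'" using gen[OF uv(1,2)] I zz(3) uv(3,4) unfolding generic_def by metis
  qed
  moreover have "(\<lambda>z. snd z ?I) ` h ` universe T \<subseteq> {..<card ?I - 1}"
    using hU I unfolding mem_free_structure_iff by auto
  ultimately have "card (h ` universe T) \<le> card ?I - 1"
    by (metis card_inj_on_le card_lessThan finite_lessThan)
  moreover have "card ?I \<le> card (h ` universe T)"
    using T(2) unfolding image_comp[symmetric] finite_structure_def by (simp add: card_image_le)
  \<comment> \<open>With truncated subtraction an empty image would satisfy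
    \<open>card ?I \<le> card ?I - 1\<close>.\<close>
  moreover have "card ?I > 0"
    using ne I T(2) by (metis card_gt_0_iff finite_imageI finite_structure_def)
  ultimately show False by linarith
qed

end

text \<open>The type of \<open>B\<close> displays the two layers of decoration: sets of marks over
  \<open>E\<close>, then value functions over the parity structure.\<close>

lemma free_coherent_extension_exists:
  fixes E :: "('a, 'r) rel_structure"
  assumes L: "finite (symbols L)" and E: "is_structure L E" "finite_structure E" "is_free L \<T> E"
    and T: "\<And>T. T \<in> \<T> \<Longrightarrow> is_structure L T \<and> finite_structure T \<and> gaifman_clique L T"
  shows "\<exists>(B :: (('a \<times> ('r \<times> 'a list) set) \<times> (('a \<times> ('r \<times> 'a list) set) set \<Rightarrow> nat), 'r) rel_structure) \<iota> \<Phi>.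
    coherent_extension L E B \<iota> \<Phi> \<and> is_free L \<T> B"
proof -
  obtain H where "functorial_extension (universe E) H"
    using functorial_extension_exists E(2) unfolding finite_structure_def by blast
  then interpret parity_extension L E H
    using L E unfolding parity_extension_def parity_extension_axioms_def by blast
  have "\<forall>n. \<exists>K. functorial_extension {..<n::nat} K"
    using functorial_extension_exists by blast
  then obtain K where K: "\<And>n::nat. functorial_extension {..<n} (K n)" by metis
  let ?B = parity_structure and ?bad = "forbidden_images L \<T> parity_structure"
  \<comment> \<open>Freeness of \<open>E\<close> enters here: a forbidden image inside the copy
    would pull back to a homomorphism into \<open>E\<close>.\<close>
  have proper: "\<not> I \<subseteq> point ` universe E" if "I \<in> ?bad" for I
    using that homomorphism_into_embedding[OF point_embedding] T E(3)
    unfolding forbidden_images_def is_free_def by blast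
  have "\<exists>c. inj_on c {x \<in> universe E. point x \<in> I} \<and> c ` {x \<in> universe E. point x \<in> I} \<subseteq> {..<card I - 1}"
    if I: "I \<in> ?bad" for I
  proof -
    let ?S = "{x \<in> universe E. point x \<in> I}"
    have fI: "finite I"
      using I T unfolding forbidden_images_def finite_structure_def by blast
    \<comment> \<open>At least one point of \<open>I\<close> is outside the copy, so
      \<open>card I - 1\<close> values suffice for the points inside it.\<close>
    have "point ` ?S \<subset> I" using proper[OF I] by blast
    then have "card (point ` ?S) < card I" using fI by (simp add: psubset_card_mono)
    moreover have "inj_on point ?S" by (metis fst_point inj_onI)
    ultimately have "card ?S \<le> card {..<card I - 1}" by (simp add: card_image)
    then show ?thesis
      using fin card_le_inj[of ?S "{..<card I - 1}"] by (auto simp: finite_structure_def)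
  qed
  then have "\<forall>I\<in>?bad. \<exists>c. inj_on c {x \<in> universe E. point x \<in> I} \<and>
    c ` {x \<in> universe E. point x \<in> I} \<subseteq> {..<card I - 1}" by blast
  from bchoice[OF this] obtain col where col: "\<forall>I\<in>?bad. inj_on (col I) {x \<in> universe E. point x \<in> I} \<and>
    col I ` {x \<in> universe E. point x \<in> I} \<subseteq> {..<card I - 1}" by blast
  interpret F: clique_free_extension L E ?B point lift \<T> col K
    by (intro clique_free_extension.intro clique_free_extension_axioms.intro
        parity.coherent_extension_axioms K) (use col in auto)
  \<comment> \<open>\<open>proper\<close> also excludes the empty image, which is contained in every
    set.\<close>
  have "is_free L \<T> F.free_structure" using F.free[OF T] proper by blast
  then show ?thesis using F.free.coherent_extension_axioms by blast
qed


section \<open>Transport to the natural numbers\<close>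

text \<open>The structure constructed so far lives on a type depending on \<open>E\<close>. Being
  finite, it can be copied onto natural numbers, the type required of \<open>D2\<close>.\<close>

definition image_structure :: "('b \<Rightarrow> 'c) \<Rightarrow> ('b, 'r) rel_structure \<Rightarrow> ('c, 'r) rel_structure" where
  "image_structure e B = \<lparr>universe = e ` universe B, interp = (\<lambda>R. map e ` interp B R)\<rparr>"

lemma image_structure_embedding:
  assumes "is_structure L B" "inj_on e (universe B)"
  shows "embedding L B (image_structure e B) e"
  unfolding embedding_def
proof (intro conjI ballI assms(2))
  show "e ` universe B \<subseteq> universe (image_structure e B)" by (simp add: image_structure_def)
  fix R xs assume R: "R \<in> symbols L" and xs: "xs \<in> lists (universe B)"
  have "ys = xs" if ys: "ys \<in> interp B R" and eq: "map e ys = map e xs" for ys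
  proof -
    have "ys \<in> lists (universe B)" using assms(1) R ys by (auto simp: is_structure_def)
    then have "set ys \<union> set xs \<subseteq> universe B" using xs by auto
    then have "inj_on e (set ys \<union> set xs)" using assms(2) by (rule inj_on_subset[rotated])
    then show ?thesis using map_inj_on[OF eq] by simp
  qed
  then show "xs \<in> interp B R \<longleftrightarrow> map e xs \<in> interp (image_structure e B) R"
    by (force simp: image_structure_def)
qed

text \<open>Composition with this map turns a homomorphism into the copy into one into
  \<open>B\<close>, so the copy remains free.\<close>

lemma image_structure_homomorphism:
  assumes "is_structure L B" "inj_on e (universe B)"
  shows "homomorphism L (image_structure e B) B (inv_into (universe B) e)"
  unfolding homomorphism_def
proof (intro conjI ballI)
  show "inv_into (universe B) e \<in> universe (image_structure e B) \<rightarrow> universe B"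
    using assms(2) by (auto simp: image_structure_def)
  fix R zs assume R: "R \<in> symbols L" and "zs \<in> interp (image_structure e B) R"
  then obtain xs where xs: "xs \<in> interp B R" "zs = map e xs" by (auto simp: image_structure_def)
  have "set xs \<subseteq> universe B" using assms(1) R xs(1) by (auto simp: is_structure_def)
  then have "map (inv_into (universe B) e) zs = xs"
    using assms(2) xs(2) by (auto intro!: map_idI simp: subset_iff)
  then show "map (inv_into (universe B) e) zs \<in> interp B R" using xs(1) by simp
qed

lemma embedding_homomorphism:
  assumes "is_structure L A" "embedding L A B f"
  shows "homomorphism L A B f"
  using assms unfolding homomorphism_def embedding_def is_structure_def by blast

lemma is_free_homomorphism:
  "is_free L \<T> B \<Longrightarrow> homomorphism L A B f \<Longrightarrow> is_free L \<T> A"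
  unfolding is_free_def using homomorphism_comp by blast

lemma (in coherent_extension) transport:
  assumes e: "inj_on e (universe B)"
  shows "coherent_extension L E (image_structure e B) (e \<circ> \<iota>)
    (\<lambda>p. e \<circ> \<Phi> p \<circ> inv_into (universe B) e)"
proof
  let ?g = "inv_into (universe B) e"
  show "is_structure L (image_structure e B)"
    using struct by (fastforce simp: is_structure_def image_structure_def)
  show "finite_structure (image_structure e B)"
    using fin by (simp add: finite_structure_def image_structure_def)
  show "embedding L E (image_structure e B) (e \<circ> \<iota>)"
    by (rule embedding_comp[OF emb image_structure_embedding[OF struct e]])
  have U: "\<And>c. c \<in> universe (image_structure e B) \<Longrightarrow> \<exists>b\<in>universe B. c = e b"
    by (auto simp: image_structure_def)
  have g: "?g (e b) = b" if "b \<in> universe B" for b using e that by simp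
  show "homomorphism L (image_structure e B) (image_structure e B) (e \<circ> \<Phi> p \<circ> ?g)"
    if "p \<in> iso_graphs L E" for p
    using homomorphism_comp[OF image_structure_homomorphism[OF struct e] homomorphism_comp[OF hom[OF that]
      embedding_homomorphism[OF struct image_structure_embedding[OF struct e]]]]
    by (simp add: comp_assoc)
  show "(e \<circ> \<Phi> p \<circ> ?g) ((e \<circ> \<iota>) x) = (e \<circ> \<iota>) y" if "p \<in> iso_graphs L E" "(x, y) \<in> p" for p x y
  proof -
    have "x \<in> universe E" using iso_graphs_Domain_Range[OF that(1)] that(2) by blast
    then have "\<iota> x \<in> universe B" using emb by (auto simp: embedding_def)
    then show ?thesis using extends[OF that] g by simp
  qed
  show "(e \<circ> \<Phi> (p O q) \<circ> ?g) c = (e \<circ> \<Phi> q \<circ> ?g) ((e \<circ> \<Phi> p \<circ> ?g) c)"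
    if "p \<in> iso_graphs L E" "q \<in> iso_graphs L E" "Range p = Domain q"
      "c \<in> universe (image_structure e B)" for p q c
    using U[OF that(4)] comp[OF that(1-3)] maps[OF that(1)] g by auto
  show "(e \<circ> \<Phi> (Id_on S) \<circ> ?g) c = c"
    if "S \<subseteq> universe E" "c \<in> universe (image_structure e B)" for S c
    using U[OF that(2)] ident[OF that(1)] g by auto
qed


section \<open>Free amalgams\<close>

locale amalgamation =
  fixes L :: "'r language" and C1 C2 :: "('a, 'r) rel_structure" and D1 :: "('b, 'r) rel_structure"
    and \<iota>1 :: "'a \<Rightarrow> 'b"
  assumes C2: "is_structure L C2" and D1: "is_structure L D1"
    and sub: "substructure L C1 C2" and emb: "embedding L C1 D1 \<iota>1"
begin

text \<open>Points of \<open>C1\<close> are represented by their copies in \<open>D1\<close>, so the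
  identification needs no quotient.\<close>

definition glue :: "'a \<Rightarrow> 'a + 'b" where
  "glue x = (if x \<in> universe C1 then Inr (\<iota>1 x) else Inl x)"

definition amalgam :: "('a + 'b, 'r) rel_structure" where
  "amalgam = \<lparr>universe = glue ` universe C2 \<union> Inr ` universe D1,
     interp = (\<lambda>R. map glue ` interp C2 R \<union> map Inr ` interp D1 R)\<rparr>"

lemma amalgam_structure: "is_structure L amalgam"
  using C2 D1 by (fastforce simp: is_structure_def amalgam_def)

lemma inj_glue: "inj_on glue (universe C2)"
  using emb by (auto simp: glue_def inj_on_def embedding_def)

text \<open>A tuple seen in both factors comes from \<open>C1\<close>, where the factors have the
  same relations by \<open>interp_iff\<close>. Hence neither factor acquires new relations from the
  other.\<close>

lemma map_glue_eq_map_Inr: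
  "map glue xs = map Inr ys \<longleftrightarrow> set xs \<subseteq> universe C1 \<and> ys = map \<iota>1 xs"
proof (induction xs arbitrary: ys)
  case (Cons x xs)
  then show ?case by (cases ys) (auto simp: glue_def)
qed auto

lemma interp_iff:
  assumes "R \<in> symbols L" "set xs \<subseteq> universe C1"
  shows "xs \<in> interp C2 R \<longleftrightarrow> map \<iota>1 xs \<in> interp D1 R"
proof -
  have "xs \<in> interp C1 R \<longleftrightarrow> xs \<in> interp C2 R" using assms sub by (simp add: substructure_def)
  moreover have "xs \<in> lists (universe C1)" using assms(2) by (auto simp: subset_iff)
  ultimately show ?thesis using emb assms(1) by (simp add: embedding_def)
qed

lemma Inr_embedding: "embedding L D1 amalgam Inr"
  unfolding embedding_def
proof (intro conjI ballI)
  fix R ys assume R: "R \<in> symbols L" and ys: "ys \<in> lists (universe D1)"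
  show "ys \<in> interp D1 R \<longleftrightarrow> map Inr ys \<in> interp amalgam R"
  proof
    assume "map Inr ys \<in> interp amalgam R"
    then consider ys' where "ys' \<in> interp D1 R" "map Inr ys = (map Inr ys' :: ('a + 'b) list)"
      | xs where "xs \<in> interp C2 R" "map glue xs = map Inr ys"
      by (auto simp: amalgam_def)
    then show "ys \<in> interp D1 R"
    proof cases
      case 1
      then have "ys = ys'" using map_injective[OF _ inj_Inr] by blast
      then show ?thesis using 1 by simp
    next
      case 2
      then show ?thesis using interp_iff[OF R] by (simp add: map_glue_eq_map_Inr)
    qed
  qed (simp add: amalgam_def)
qed (auto simp: amalgam_def)

lemma glue_embedding: "embedding L C2 amalgam glue"
  unfolding embedding_def
proof (intro conjI ballI inj_glue)
  fix R xs assume R: "R \<in> symbols L" and xs: "xs \<in> lists (universe C2)"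
  show "xs \<in> interp C2 R \<longleftrightarrow> map glue xs \<in> interp amalgam R"
  proof
    assume "map glue xs \<in> interp amalgam R"
    then consider xs' where "xs' \<in> interp C2 R" "map glue xs' = map glue xs"
      | ys where "ys \<in> interp D1 R" "map glue xs = map Inr ys"
      by (auto simp: amalgam_def)
    then show "xs \<in> interp C2 R"
    proof cases
      case 1
      then have "set xs' \<union> set xs \<subseteq> universe C2" using C2 R xs by (auto simp: is_structure_def)
      then have "inj_on glue (set xs' \<union> set xs)" using inj_glue by (rule inj_on_subset[rotated])
      then show ?thesis using 1 map_inj_on by metis
    next
      case 2
      then show ?thesis using interp_iff[OF R] by (simp add: map_glue_eq_map_Inr)
    qed
  qed (simp add: amalgam_def)
qed (auto simp: amalgam_def)

text \<open>If some \<open>u\<close> is mapped outside the copy of \<open>D1\<close>, every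
  \<open>v\<close> shares a tuple with \<open>u\<close>. The image of that tuple cannot come from
  \<open>D1\<close>, so it comes from \<open>C2\<close> and takes \<open>v\<close> with it.\<close>

lemma clique_image:
  assumes T: "gaifman_clique L T" and h: "homomorphism L T amalgam h"
  shows "h ` universe T \<subseteq> glue ` universe C2 \<or> h ` universe T \<subseteq> Inr ` universe D1"
proof (rule disjCI)
  assume "\<not> h ` universe T \<subseteq> Inr ` universe D1"
  then obtain u where u: "u \<in> universe T" "h u \<notin> Inr ` universe D1" by blast
  show "h ` universe T \<subseteq> glue ` universe C2"
  proof (rule image_subsetI)
    fix v assume v: "v \<in> universe T"
    obtain R cs where R: "R \<in> symbols L" and cs: "cs \<in> interp T R" "u \<in> set cs" "v \<in> set cs"
      using T u(1) v unfolding gaifman_clique_def by blast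
    have "map h cs \<in> interp amalgam R" using h R cs(1) by (auto simp: homomorphism_def)
    moreover have "map h cs \<noteq> map Inr ys" if "ys \<in> interp D1 R" for ys
    proof
      assume "map h cs = map Inr ys"
      then have "h u \<in> Inr ` set ys" using cs(2) by (metis image_eqI image_set)
      then show False using u(2) D1 R that by (auto simp: is_structure_def)
    qed
    ultimately obtain xs where "xs \<in> interp C2 R" "map h cs = map glue xs"
      by (auto simp: amalgam_def)
    then have "set xs \<subseteq> universe C2" "h v \<in> glue ` set xs"
      using C2 R cs(3) by (auto simp: is_structure_def) (metis image_eqI image_set)
    then show "h v \<in> glue ` universe C2" by blast
  qed
qed

lemma amalgam_free:
  assumes T: "\<And>T. T \<in> \<T> \<Longrightarrow> is_structure L T \<and> gaifman_clique L T"
    and "is_free L \<T> C2" "is_free L \<T> D1"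
  shows "is_free L \<T> amalgam"
  unfolding is_free_def
proof safe
  fix T h assume "T \<in> \<T>" and h: "homomorphism L T amalgam h"
  then have T: "is_structure L T" "gaifman_clique L T" using T by auto
  show False
    using clique_image[OF T(2) h] homomorphism_into_embedding[OF glue_embedding T(1) h]
      homomorphism_into_embedding[OF Inr_embedding T(1) h] assms(2,3) \<open>T \<in> \<T>\<close>
    unfolding is_free_def by blast
qed

end


section \<open>Automorphisms from partial isomorphisms\<close>

lemma graph_iso_graphs:
  assumes A: "substructure L A C" and B: "substructure L B C" and f: "isomorphism L A B f"
  shows "(\<lambda>x. (x, f x)) ` universe A \<in> iso_graphs L C"
proof -
  let ?p = "(\<lambda>x. (x, f x)) ` universe A"
  have bij: "bij_betw f (universe A) (universe B)" using f by (simp add: isomorphism_def)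
  have "xs \<in> interp C R \<longleftrightarrow> ys \<in> interp C R"
    if R: "R \<in> symbols L" and l: "list_all2 (\<lambda>x y. (x, y) \<in> ?p) xs ys" for R xs ys
  proof -
    have xy: "xs \<in> lists (universe A) \<and> ys = map f xs" using l
      by (induction rule: list_all2_induct) auto
    then have "set xs \<subseteq> universe A" "set ys \<subseteq> universe B"
      using bij by (auto simp: bij_betw_def)
    then show ?thesis using A B f R xy by (auto simp: substructure_def isomorphism_def)
  qed
  moreover have "?p \<in> partial_injections (universe C)"
    using bij A B
    by (auto simp: partial_injections_def single_valued_def substructure_def bij_betw_def inj_on_def)
  ultimately show ?thesis by (simp add: iso_graphs_def)
qed

lemma nonid_partial_isos_iso_graphs: "nonid_partial_isos L C \<subseteq> iso_graphs L C"
  unfolding nonid_partial_isos_def partial_isos_def using graph_iso_graphs by blast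

text \<open>Along \<open>glue\<close> this carries partial isomorphisms of \<open>C2\<close>, and
  along \<open>Inr\<close> automorphisms of \<open>D1\<close>, to partial isomorphisms of the
  amalgam.\<close>

lemma iso_graphs_embedding:
  assumes e: "embedding L C E j" and p: "p \<in> iso_graphs L C"
  shows "map_prod j j ` p \<in> iso_graphs L E"
proof -
  have pU: "p \<subseteq> universe C \<times> universe C" and sv: "single_valued p" "single_valued (p\<inverse>)"
    using p by (auto simp: iso_graphs_def partial_injections_def)
  have inj: "\<And>x y. x \<in> universe C \<Longrightarrow> y \<in> universe C \<Longrightarrow> j x = j y \<Longrightarrow> x = y"
    using e by (auto simp: embedding_def inj_on_def)
  have "zs \<in> interp E R \<longleftrightarrow> ws \<in> interp E R"
    if R: "R \<in> symbols L" and l: "list_all2 (\<lambda>x y. (x, y) \<in> map_prod j j ` p) zs ws" for R zs ws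
  proof -
    have "\<exists>xs ys. zs = map j xs \<and> ws = map j ys \<and> list_all2 (\<lambda>x y. (x, y) \<in> p) xs ys"
      using l
    proof (induction rule: list_all2_induct)
      case (Cons z zs w ws)
      then obtain x y xs ys where "(x, y) \<in> p" "z = j x" "w = j y" "zs = map j xs" "ws = map j ys"
        "list_all2 (\<lambda>x y. (x, y) \<in> p) xs ys" by auto
      then show ?case by (intro exI[of _ "x # xs"] exI[of _ "y # ys"]) simp
    qed simp
    then obtain xs ys where xy: "zs = map j xs" "ws = map j ys" "list_all2 (\<lambda>x y. (x, y) \<in> p) xs ys"
      by blast
    from xy(3) have "xs \<in> lists (universe C) \<and> ys \<in> lists (universe C)"
      using pU by (induction rule: list_all2_induct) auto
    then have "xs \<in> interp C R \<longleftrightarrow> zs \<in> interp E R" "ys \<in> interp C R \<longleftrightarrow> ws \<in> interp E R"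
      using e R xy(1,2) by (simp_all add: embedding_def)
    then show ?thesis using p R xy(3) by (simp add: iso_graphs_def)
  qed
  moreover have "map_prod j j ` p \<in> partial_injections (universe E)"
    unfolding partial_injections_def
  proof (intro CollectI conjI single_valuedI)
    show "map_prod j j ` p \<subseteq> universe E \<times> universe E" using e pU by (auto simp: embedding_def)
    fix a b c
    show "b = c" if "(a, b) \<in> map_prod j j ` p" "(a, c) \<in> map_prod j j ` p"
    proof -
      have "\<exists>x y. (x, y) \<in> p \<and> a = j x \<and> b = j y" "\<exists>x y. (x, y) \<in> p \<and> a = j x \<and> c = j y"
        using that by auto
      then obtain x y x' y' where xy: "(x, y) \<in> p" "(x', y') \<in> p" "a = j x" "a = j x'" "b = j y" "c = j y'"
        by blast
      then have "x = x'" using inj[of x x'] pU by auto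
      then show ?thesis using xy sv by (metis single_valuedD)
    qed
    show "b = c" if "(a, b) \<in> (map_prod j j ` p)\<inverse>" "(a, c) \<in> (map_prod j j ` p)\<inverse>"
    proof -
      have "\<exists>x y. (y, x) \<in> p \<and> a = j x \<and> b = j y" "\<exists>x y. (y, x) \<in> p \<and> a = j x \<and> c = j y"
        using that by auto
      then obtain x y x' y' where xy: "(y, x) \<in> p" "(y', x') \<in> p" "a = j x" "a = j x'" "b = j y" "c = j y'"
        by blast
      then have "x = x'" using inj[of x x'] pU by auto
      then show ?thesis using xy sv by (metis single_valuedD converseI)
    qed
  qed
  ultimately show ?thesis by (simp add: iso_graphs_def)
qed

lemma map_prod_converse: "(map_prod j j ` p)\<inverse> = map_prod j j ` p\<inverse>"
  by force

lemma Aut_group_mult: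
  assumes "f \<in> carrier (Aut_group L D)" "g \<in> carrier (Aut_group L D)"
  shows "f \<otimes>\<^bsub>Aut_group L D\<^esub> g = compose (universe D) f g"
  using assms by (auto simp: Aut_group_def BijGroup_def Bij_def isomorphism_def)

lemma Aut_group_one: "\<one>\<^bsub>Aut_group L D\<^esub> = (\<lambda>x\<in>universe D. x)"
  by (simp add: Aut_group_def BijGroup_def)

lemma carrier_Aut_group:
  "g \<in> carrier (Aut_group L D) \<longleftrightarrow> g \<in> extensional (universe D) \<and> isomorphism L D D g"
  by (simp add: Aut_group_def)

section \<open>The embedding of automorphism groups induced by an embedding of structures\<close>

context coherent_extension
begin

definition aut :: "('a \<times> 'a) set \<Rightarrow> 'b \<Rightarrow> 'b" where
  "aut p = restrict (\<Phi> p) (universe B)"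

lemma aut_carrier: "p \<in> iso_graphs L E \<Longrightarrow> aut p \<in> carrier (Aut_group L B)"
  unfolding carrier_Aut_group aut_def using iso
  by (subst isomorphism_cong[of B _ "\<Phi> p"]) auto

text \<open>\<open>p O q\<close> performs \<open>p\<close> first, whence the reversed order of the
  factors.\<close>

lemma aut_mult:
  assumes "p \<in> iso_graphs L E" "q \<in> iso_graphs L E" "Range p = Domain q"
  shows "aut q \<otimes>\<^bsub>Aut_group L B\<^esub> aut p = aut (p O q)"
  unfolding Aut_group_mult[OF aut_carrier[OF assms(2)] aut_carrier[OF assms(1)]]
  using comp[OF assms] maps[OF assms(1)] by (auto simp: aut_def compose_def)

lemma aut_inv:
  assumes p: "p \<in> iso_graphs L E"
  shows "aut (p\<inverse>) = inv\<^bsub>Aut_group L B\<^esub> aut p"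
proof -
  interpret group "Aut_group L B" by (rule group_Aut_group)
  have "aut (p\<inverse>) \<otimes>\<^bsub>Aut_group L B\<^esub> aut p = aut (p O p\<inverse>)"
    by (rule aut_mult[OF p iso_graphs_converse[OF p]]) simp
  also have "\<dots> = \<one>\<^bsub>Aut_group L B\<^esub>"
    using ident iso_graphs_Domain_Range[OF p]
    by (auto simp: iso_graphs_relcomp_converse[OF p] aut_def Aut_group_one)
  finally show ?thesis
    using inv_equality aut_carrier p iso_graphs_converse by metis
qed

lemma aut_embed:
  assumes "p \<in> iso_graphs L E" "(x, y) \<in> p"
  shows "aut p (\<iota> x) = \<iota> y"
proof -
  have "x \<in> universe E" using iso_graphs_Domain_Range[OF assms(1)] assms(2) by blast
  then have "\<iota> x \<in> universe B" using emb by (auto simp: embedding_def)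
  then show ?thesis using extends[OF assms] by (simp add: aut_def)
qed

definition aut_of_aut :: "('d \<Rightarrow> 'a) \<Rightarrow> ('d, 'r) rel_structure \<Rightarrow> ('d \<Rightarrow> 'd) \<Rightarrow> 'b \<Rightarrow> 'b" where
  "aut_of_aut j D g = aut (map_prod j j ` (\<lambda>d. (d, g d)) ` universe D)"

context
  fixes D :: "('d, 'r) rel_structure" and j :: "'d \<Rightarrow> 'a"
  assumes D: "is_structure L D" and j: "embedding L D E j"
begin

lemma graph_in_iso_graphs:
  assumes "g \<in> carrier (Aut_group L D)"
  shows "map_prod j j ` (\<lambda>d. (d, g d)) ` universe D \<in> iso_graphs L E"
proof (rule iso_graphs_embedding[OF j graph_iso_graphs])
  show "substructure L D D" using D by (auto simp: substructure_def is_structure_def)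
  then show "substructure L D D" .
  show "isomorphism L D D g" using assms by (simp add: carrier_Aut_group)
qed

lemma aut_of_aut_embed:
  assumes "g \<in> carrier (Aut_group L D)" "d \<in> universe D"
  shows "aut_of_aut j D g (\<iota> (j d)) = \<iota> (j (g d))"
  unfolding aut_of_aut_def using assms(2) by (intro aut_embed graph_in_iso_graphs[OF assms(1)]) force

text \<open>The graphs of automorphisms of \<open>D\<close> all have the copy of
  \<open>universe D\<close> in \<open>E\<close> as domain and as range, so any two of them are
  composable in the sense of \<open>comp\<close>.\<close>

lemma aut_of_aut_hom: "aut_of_aut j D \<in> hom (Aut_group L D) (Aut_group L B)"
proof (rule homI)
  fix g assume g: "g \<in> carrier (Aut_group L D)"
  show "aut_of_aut j D g \<in> carrier (Aut_group L B)"
    unfolding aut_of_aut_def by (rule aut_carrier[OF graph_in_iso_graphs[OF g]])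
  fix f assume f: "f \<in> carrier (Aut_group L D)"
  let ?gr = "\<lambda>g. map_prod j j ` (\<lambda>d. (d, g d)) ` universe D"
  have im: "f ` universe D = universe D" "g ` universe D = universe D"
    using f g by (auto simp: carrier_Aut_group isomorphism_def bij_betw_def)
  have inj: "\<And>x y. x \<in> universe D \<Longrightarrow> y \<in> universe D \<Longrightarrow> j x = j y \<Longrightarrow> x = y"
    using j by (auto simp: embedding_def inj_on_def)
  have "Range (?gr f) = j ` f ` universe D" "Domain (?gr g) = j ` universe D"
    by (auto simp: image_image Range_snd Domain_fst)
  then have "aut (?gr g) \<otimes>\<^bsub>Aut_group L B\<^esub> aut (?gr f) = aut (?gr f O ?gr g)"
    using im by (intro aut_mult graph_in_iso_graphs f g) simp
  also have "?gr f O ?gr g = ?gr (compose (universe D) g f)"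
  proof
    show "?gr f O ?gr g \<subseteq> ?gr (compose (universe D) g f)"
    proof (rule subrelI)
      fix a c assume "(a, c) \<in> ?gr f O ?gr g"
      then obtain d d' where d: "d \<in> universe D" "a = j d" "d' \<in> universe D" "j (f d) = j d'" "c = j (g d')"
        by auto
      then have "d' = f d" using inj im by blast
      then show "(a, c) \<in> ?gr (compose (universe D) g f)"
        using d by (force simp: compose_def)
    qed
    show "?gr (compose (universe D) g f) \<subseteq> ?gr f O ?gr g"
    proof (rule subrelI)
      fix a c assume "(a, c) \<in> ?gr (compose (universe D) g f)"
      then obtain d where d: "d \<in> universe D" "a = j d" "c = j (g (f d))"
        by (auto simp: compose_def)
      then have fd: "f d \<in> universe D" using im by blast
      have "(a, j (f d)) \<in> ?gr f" "(j (f d), c) \<in> ?gr g"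
        using imageI[OF d(1), of "\<lambda>d. map_prod j j (d, f d)"]
          imageI[OF fd, of "\<lambda>d. map_prod j j (d, g d)"] unfolding image_image d(2,3) by simp_all
      then show "(a, c) \<in> ?gr f O ?gr g" by (rule relcompI)
    qed
  qed
  finally show "aut_of_aut j D (g \<otimes>\<^bsub>Aut_group L D\<^esub> f) =
      aut_of_aut j D g \<otimes>\<^bsub>Aut_group L B\<^esub> aut_of_aut j D f"
    by (simp add: aut_of_aut_def Aut_group_mult[OF g f])
qed

text \<open>The extension of \<open>g\<close> acts as \<open>g\<close> on the copy of
  \<open>D\<close> inside \<open>B\<close>, so \<open>g\<close> can be recovered from it.\<close>

lemma inj_aut_of_aut: "inj_on (aut_of_aut j D) (carrier (Aut_group L D))"
proof (rule inj_onI)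
  fix f g assume fg: "f \<in> carrier (Aut_group L D)" "g \<in> carrier (Aut_group L D)"
    "aut_of_aut j D f = aut_of_aut j D g"
  have inj: "inj_on (\<iota> \<circ> j) (universe D)"
    using embedding_comp[OF j emb] by (simp add: embedding_def)
  show "f = g"
  proof (rule extensionalityI)
    show "f \<in> extensional (universe D)" "g \<in> extensional (universe D)"
      using fg by (auto simp: carrier_Aut_group)
    fix d assume d: "d \<in> universe D"
    have "(\<iota> \<circ> j) (f d) = (\<iota> \<circ> j) (g d)"
      using aut_of_aut_embed[OF fg(1) d] aut_of_aut_embed[OF fg(2) d] fg(3) by simp
    moreover have "f d \<in> universe D" "g d \<in> universe D"
      using fg d by (auto simp: carrier_Aut_group isomorphism_def bij_betw_def)
    ultimately show "f d = g d" by (rule inj_onD[OF inj])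
  qed
qed

end

end

text \<open>Existence is by restricting \<open>\<Psi>\<close>; uniqueness holds because a
  homomorphism is determined by its values on generators. \<open>T\<close> may exceed the image of
  \<open>S\<close>, since \<open>C2\<close> contributes further generators.\<close>

lemma unique_mon_subgroup_generated:
  assumes "group G" "group H" and h: "\<Psi> \<in> hom G H" and inj: "inj_on \<Psi> (carrier G)"
    and S: "S \<subseteq> carrier G" and T: "\<Psi> ` S \<subseteq> T" "T \<subseteq> carrier H"
  shows "\<exists>!h. h \<in> mon (subgroup_generated G S) (subgroup_generated H T) \<and>
    h \<in> extensional (carrier (subgroup_generated G S)) \<and> (\<forall>g\<in>S. h g = \<Psi> g)"
proof -
  interpret G: group G by fact
  interpret H: group H by fact
  interpret \<Psi>: group_hom G H \<Psi> using h by unfold_locales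
  let ?G = "subgroup_generated G S" and ?H = "subgroup_generated H T"
  have cG: "carrier ?G = generate G S" and cH: "carrier ?H = generate H T"
    using S T by (simp_all add: carrier_subgroup_generated Int_absorb1)
  have GG: "generate G S \<subseteq> carrier G" by (rule G.generate_incl[OF S])
  have HH: "generate H T \<subseteq> carrier H" by (rule H.generate_incl[OF T(2)])
  have \<Psi>_mem: "\<Psi> g \<in> generate H T" if "g \<in> generate G S" for g
    using that
  proof (induction rule: generate.induct)
    case one
    then show ?case by (simp add: generate.one)
  next
    case (incl g)
    then show ?case using T by (auto intro: generate.incl)
  next
    case (inv g)
    then have "\<Psi> (inv\<^bsub>G\<^esub> g) = inv\<^bsub>H\<^esub> \<Psi> g" using S by auto
    then show ?case using inv T by (auto intro: generate.inv)
  next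
    case (eng g h)
    then have "\<Psi> (g \<otimes>\<^bsub>G\<^esub> h) = \<Psi> g \<otimes>\<^bsub>H\<^esub> \<Psi> h"
      using GG \<Psi>.hom_mult by blast
    then show ?case using eng by (auto intro: generate.eng)
  qed
  let ?h = "restrict \<Psi> (carrier ?G)"
  have "?h \<in> mon ?G ?H"
  proof -
    have "?h \<in> hom ?G ?H"
      using \<Psi>_mem GG by (intro homI) (auto simp: cG cH generate.eng subset_iff)
    moreover have "inj_on ?h (carrier ?G)"
      using inj_on_subset[OF inj GG] by (simp add: cG)
    ultimately show ?thesis by (simp add: mon_def)
  qed
  moreover have "\<forall>g\<in>S. ?h g = \<Psi> g" by (auto simp: cG generate.incl)
  moreover have "k = ?h" if k: "k \<in> hom ?G ?H" and ext: "k \<in> extensional (carrier ?G)"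
    and eq: "\<forall>g\<in>S. k g = \<Psi> g" for k
  proof (rule extensionalityI[OF ext])
    interpret k: group_hom ?G ?H k
      using k by (intro group_hom.intro group_hom_axioms.intro) auto
    fix g assume "g \<in> carrier ?G"
    then have "g \<in> generate G S" by (simp add: cG)
    then have "k g = \<Psi> g"
    proof (induction rule: generate.induct)
      case one
      then show ?case using k.hom_one by simp
    next
      case (incl g)
      then show ?case using eq by simp
    next
      case (inv g)
      have m: "g \<in> generate G S" "inv\<^bsub>G\<^esub> g \<in> generate G S"
        using inv by (auto intro: generate.intros)
      \<comment> \<open>The inverse is identified in \<open>H\<close>, whose multiplication and unit
        \<open>?H\<close> shares.\<close>
      then have "k (inv\<^bsub>G\<^esub> g) \<otimes>\<^bsub>H\<^esub> k g = k (inv\<^bsub>G\<^esub> g \<otimes>\<^bsub>G\<^esub> g)"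
        using k.hom_mult[of "inv\<^bsub>G\<^esub> g" g] by (simp add: cG)
      also have "\<dots> = \<one>\<^bsub>H\<^esub>" using k.hom_one m GG by auto
      finally have "k (inv\<^bsub>G\<^esub> g) \<otimes>\<^bsub>H\<^esub> k g = \<one>\<^bsub>H\<^esub>" .
      moreover have "k g \<in> carrier H" "k (inv\<^bsub>G\<^esub> g) \<in> carrier H"
        using m k.hom_closed HH by (auto simp: cG cH)
      ultimately have "inv\<^bsub>H\<^esub> (k g) = k (inv\<^bsub>G\<^esub> g)" by (rule H.inv_equality)
      then show ?case using eq inv S by (metis \<Psi>.hom_inv subsetD)
    next
      case (eng g h)
      then have "k (g \<otimes>\<^bsub>G\<^esub> h) = \<Psi> g \<otimes>\<^bsub>H\<^esub> \<Psi> h"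
        using k.hom_mult[of g h] by (simp add: cG)
      also have "\<dots> = \<Psi> (g \<otimes>\<^bsub>G\<^esub> h)" using eng GG \<Psi>.hom_mult by (metis subsetD)
      finally show ?case .
    qed
    then show "k g = ?h g" using \<open>g \<in> carrier ?G\<close> by simp
  qed simp
  ultimately show ?thesis by (intro ex1I[of _ ?h]) (auto simp: mon_def)
qed


section \<open>Assembly of \<open>D2\<close> and \<open>\<phi>2\<close> over the free
  amalgam\<close>

theorem theorem4p3:
  fixes L :: "'r language"
    and \<T> :: "('t, 'r) rel_structure set"
    and C1 C2 :: "('a, 'r) rel_structure"
    and D1 :: "('b, 'r) rel_structure"
    and \<iota>1 :: "'a \<Rightarrow> 'b"
    and \<phi>1 :: "('a \<times> 'a) set \<Rightarrow> 'b \<Rightarrow> 'b"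
  assumes "finite (symbols L)"
    and "finite \<T>"
    and "\<And>T. T \<in> \<T> \<Longrightarrow> is_structure L T \<and> finite_structure T \<and> gaifman_clique L T"
    and "is_structure L C1" "finite_structure C1" "is_free L \<T> C1"
    and "is_structure L C2" "finite_structure C2" "is_free L \<T> C2"
    and "substructure L C1 C2"
    and "HL_extension L C1 D1 \<iota>1 \<phi>1" "finite_structure D1" "is_free L \<T> D1"
  shows "\<exists>(D2 :: (nat, 'r) rel_structure) \<iota>2 \<phi>2.
           HL_extension L C2 D2 \<iota>2 \<phi>2 \<and> finite_structure D2 \<and> is_free L \<T> D2 \<and>
           coherent L C1 D1 \<iota>1 \<phi>1 C2 D2 \<iota>2 \<phi>2"
proof -
  let ?P1 = "nonid_partial_isos L C1" and ?P2 = "nonid_partial_isos L C2"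
  have D1: "is_structure L D1" and \<iota>1: "embedding L C1 D1 \<iota>1"
    and \<phi>1: "\<And>p. p \<in> ?P1 \<Longrightarrow> \<phi>1 p \<in> carrier (Aut_group L D1)"
    and \<phi>1_ext: "\<And>p x y. p \<in> ?P1 \<Longrightarrow> (x, y) \<in> p \<Longrightarrow> \<phi>1 p (\<iota>1 x) = \<iota>1 y"
    and \<phi>1_inv: "\<And>p. p \<in> ?P1 \<Longrightarrow> \<phi>1 (p\<inverse>) = inv\<^bsub>Aut_group L D1\<^esub> (\<phi>1 p)"
    using assms(11) by (auto simp: HL_extension_def extends_via_iff_embedding)
  interpret amalgamation L C1 C2 D1 \<iota>1
    using assms(7,10) D1 \<iota>1 by unfold_locales
  have "finite_structure amalgam"
    using assms(8,12) by (simp add: finite_structure_def amalgam_def)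
  moreover have "is_free L \<T> amalgam"
    using assms(3) by (intro amalgam_free assms(9,13)) blast
  ultimately obtain B :: "((('a + 'b) \<times> ('r \<times> ('a + 'b) list) set) \<times>
      ((('a + 'b) \<times> ('r \<times> ('a + 'b) list) set) set \<Rightarrow> nat), 'r) rel_structure" and \<iota> \<Phi>
    where B: "coherent_extension L amalgam B \<iota> \<Phi>" "is_free L \<T> B"
    using free_coherent_extension_exists[OF assms(1) amalgam_structure _ _ assms(3)] by blast
  interpret B: coherent_extension L amalgam B \<iota> \<Phi> by (rule B(1))
  obtain e :: "_ \<Rightarrow> nat" where e: "inj_on e (universe B)"
    using finite_imp_inj_to_nat_seg B.fin unfolding finite_structure_def by blast
  define D2 where "D2 = image_structure e B"
  define \<iota>' where "\<iota>' = e \<circ> \<iota>"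
  define \<Phi>' where "\<Phi>' = (\<lambda>p. e \<circ> \<Phi> p \<circ> inv_into (universe B) e)"
  interpret D2: coherent_extension L amalgam D2 \<iota>' \<Phi>'
    unfolding D2_def \<iota>'_def \<Phi>'_def by (rule B.transport[OF e])
  have free: "is_free L \<T> D2"
    unfolding D2_def by (rule is_free_homomorphism[OF B(2) image_structure_homomorphism[OF B.struct e]])
  define \<Psi> where "\<Psi> = D2.aut_of_aut Inr D1"
  \<comment> \<open>For \<open>p\<close> from \<open>C1\<close>, coherence demands that
    \<open>\<phi>2 p\<close> extend \<open>\<phi>1 p\<close> on all of \<open>D1\<close>, so the
    automorphism \<open>\<phi>1 p\<close> rather than \<open>p\<close> itself is extended. Any other
    \<open>p\<close> is extended from its glued graph.\<close>
  define \<phi>2 where "\<phi>2 p = (if p \<in> ?P1 then \<Psi> (\<phi>1 p) else D2.aut (map_prod glue glue ` p))" for p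
  have \<Psi>_hom: "\<Psi> \<in> hom (Aut_group L D1) (Aut_group L D2)"
    unfolding \<Psi>_def by (rule D2.aut_of_aut_hom[OF D1 Inr_embedding])
  interpret \<Psi>: group_hom "Aut_group L D1" "Aut_group L D2" \<Psi>
    by (intro group_hom.intro group_hom_axioms.intro group_Aut_group \<Psi>_hom)
  have \<Psi>_embed: "\<Psi> g (\<iota>' (Inr d)) = \<iota>' (Inr (g d))"
    if "g \<in> carrier (Aut_group L D1)" "d \<in> universe D1" for g d
    unfolding \<Psi>_def by (rule D2.aut_of_aut_embed[OF D1 Inr_embedding that])
  have \<phi>2: "\<phi>2 p = \<Psi> (\<phi>1 p)" if "p \<in> ?P1" for p using that by (simp add: \<phi>2_def)
  have P12: "?P1 \<subseteq> ?P2" by (rule nonid_partial_isos_mono[OF assms(10)])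
  have glued: "map_prod glue glue ` p \<in> iso_graphs L amalgam" if "p \<in> ?P2" for p
    using that nonid_partial_isos_iso_graphs by (intro iso_graphs_embedding[OF glue_embedding]) blast
  have \<phi>2_carrier: "\<phi>2 p \<in> carrier (Aut_group L D2)" if "p \<in> ?P2" for p
    using that \<phi>1 glued by (auto simp: \<phi>2_def intro: D2.aut_carrier)
  have \<phi>2_ext: "\<phi>2 p (\<iota>' (glue x)) = \<iota>' (glue y)" if p: "p \<in> ?P2" and xy: "(x, y) \<in> p" for p x y
  proof (cases "p \<in> ?P1")
    case True
    then have "p \<in> iso_graphs L C1" using nonid_partial_isos_iso_graphs by blast
    then have mem: "x \<in> universe C1" "y \<in> universe C1"
      using iso_graphs_Domain_Range xy by (metis DomainI RangeI subsetD)+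
    then have "\<iota>1 x \<in> universe D1" using \<iota>1 by (auto simp: embedding_def)
    then have "\<Psi> (\<phi>1 p) (\<iota>' (Inr (\<iota>1 x))) = \<iota>' (Inr (\<iota>1 y))"
      using \<Psi>_embed[OF \<phi>1[OF True]] \<phi>1_ext[OF True xy] by simp
    then show ?thesis using mem True by (simp add: \<phi>2 glue_def)
  next
    case False
    have "(glue x, glue y) \<in> map_prod glue glue ` p" using xy by force
    then show ?thesis using False D2.aut_embed[OF glued[OF p]] by (simp add: \<phi>2_def)
  qed
  have \<phi>2_inv: "\<phi>2 (p\<inverse>) = inv\<^bsub>Aut_group L D2\<^esub> (\<phi>2 p)" if p: "p \<in> ?P2" for p
  proof (cases "p \<in> ?P1")
    case True
    then show ?thesis
      using \<phi>1_inv[OF True] \<Psi>.hom_inv[OF \<phi>1[OF True]] nonid_partial_isos_converse[OF True]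
      by (simp add: \<phi>2)
  next
    case False
    \<comment> \<open>\<open>?P1\<close> is closed under converse, so \<open>p\<close> and
      \<open>p\<inverse>\<close> fall under the same case of \<open>\<phi>2\<close>.\<close>
    then have "p\<inverse> \<notin> ?P1" using nonid_partial_isos_converse[of "p\<inverse>"] by auto
    then show ?thesis
      using False D2.aut_inv[OF glued[OF p]] by (simp add: \<phi>2_def map_prod_converse)
  qed
  have HL: "HL_extension L C2 D2 (\<iota>' \<circ> glue) \<phi>2"
    unfolding HL_extension_def extends_via_iff_embedding
    using D2.struct embedding_comp[OF glue_embedding D2.emb] \<phi>2_carrier \<phi>2_ext \<phi>2_inv by auto
  have 1: "extends_via L D1 D2 (\<iota>' \<circ> Inr)"
    unfolding extends_via_iff_embedding by (rule embedding_comp[OF Inr_embedding D2.emb])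
  have 2: "\<forall>x\<in>universe C1. (\<iota>' \<circ> Inr) (\<iota>1 x) = (\<iota>' \<circ> glue) x" by (simp add: glue_def)
  have 3: "\<forall>p\<in>?P1. \<forall>d\<in>universe D1. \<phi>2 p ((\<iota>' \<circ> Inr) d) = (\<iota>' \<circ> Inr) (\<phi>1 p d)"
    using \<Psi>_embed \<phi>1 by (simp add: \<phi>2)
  have 4: "\<exists>!h. h \<in> mon (HL_group L C1 D1 \<phi>1) (HL_group L C2 D2 \<phi>2) \<and>
      h \<in> extensional (carrier (HL_group L C1 D1 \<phi>1)) \<and> (\<forall>g\<in>\<phi>1 ` ?P1. h g = \<Psi> g)"
    unfolding HL_group_def
  proof (rule unique_mon_subgroup_generated[OF group_Aut_group group_Aut_group \<Psi>_hom])
    show "inj_on \<Psi> (carrier (Aut_group L D1))"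
      unfolding \<Psi>_def by (rule D2.inj_aut_of_aut[OF D1 Inr_embedding])
    show "\<Psi> ` \<phi>1 ` ?P1 \<subseteq> \<phi>2 ` ?P2" using P12 \<phi>2 by force
  qed (use \<phi>1 \<phi>2_carrier in auto)
  \<comment> \<open>As \<open>\<Psi>\<close> is a map on automorphisms of \<open>D1\<close>, it
    serves as \<open>\<kappa>\<close> too: equal values of \<open>\<phi>1\<close> on
    \<open>?P1\<close> automatically give equal values of \<open>\<phi>2\<close>.\<close>
  have "coherent L C1 D1 \<iota>1 \<phi>1 C2 D2 (\<iota>' \<circ> glue) \<phi>2"
    unfolding coherent_def
  proof (intro conjI exI[of _ "\<iota>' \<circ> Inr"] exI[of _ \<Psi>])
    show "\<forall>p\<in>?P1. \<Psi> (\<phi>1 p) = \<phi>2 p" by (simp add: \<phi>2)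
  qed (fact 1 2 3 4)+
  then show ?thesis using HL D2.fin free by blast
qed

end
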